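(* The emptiness problem for probabilistic finite state transducers computing a relation with probability $2/3$ is undecidable: there is no algorithm which, given (a finite description of) a pfst $T$ that computes some relation $\mathcal R$ with probability $2/3$, decides whether $\mathcal R=\emptyset$. Likewise, the emptiness problem for quantum finite state transducers computing a relation with probability $2/3$ is undecidable.
   Context: A probabilistic finite state transducer (pfst) is a tuple $T=(Q,\Sigma_1,\Sigma_2,V,f,q_0,Q_{\rm acc},Q_{\rm rej})$ with finite state set $Q$, finite input/output alphabets $\Sigma_1,\Sigma_2$, initial state $q_0$, disjoint accepting/rejecting sets $Q_{\rm acc},Q_{\rm rej}\subseteq Q$ (the other states are non-halting). For each $a\in\Sigma_1\cup\{\ddagger,\$\}$ ($\ddagger,\$$ are end markers) there is a stochastic $Q\times Q$ matrix $V_a$ and an output function $f_a:Q\to\Sigma_2^*$; $V_\$$ puts all probability on halting states. On input $v$ the machine reads $\ddagger v\$$; in state $q$ reading $a$ it appends $f_a(q)$ to the output tape and moves to state $p$ with probability $(V_a)_{qp}$; if $p$ is accepting (rejecting) it halts and accepts with the current output (rejects). $T(w|v)$ is the probability of accepting with output $w$ on input $v$. A quantum finite state transducer (qfst) has the same data except that each $V_a$ is a unitary on $\ell^2(Q)$ (and $V_\$$ maps the span of non-halting states into the span of halting states). Its non-halting part is a vector $\psi=\sum_{q,w}\alpha_{qw}|q\rangle\otimes|w\rangle\in\ell^2(Q\times\Sigma_2^* )$, initially $|q_0\rangle\otimes|\epsilon\rangle$; reading $a$ maps it to $\psi'=\sum_{q,w}\alpha_{qw}V_a|q\rangle\otimes|wf_a(q)\rangle$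 with $V_a|q\rangle=\sum_p(V_a)_{qp}|p\rangle$, after which the squared norm of the component of $\psi'$ on $\mathrm{span}(Q_{\rm acc})\otimes|x\rangle$ is added to the probability of accepting with output $x$, the squared norm of the component on $\mathrm{span}(Q_{\rm rej})\otimes\ell^2(\Sigma_2^* )$ to the rejection probability, and the computation continues with the projection onto non-halting states. $T(w|v)$ is defined analogously. For $\alpha>1/2$, $T$ computes $\mathcal R\subseteq\Sigma_1^*\times\Sigma_2^*$ with probability $\alpha$ if for all $v,w$: $(v,w)\in\mathcal R\Rightarrow T(w|v)\ge\alpha$ and $(v,w)\notin\mathcal R\Rightarrow T(w|v)\le1-\alpha$. *)

theory Defs
  imports Complex_Main "HOL-Library.Nat_Bijection"
begin

datatype recf = Z | S | Id nat | Cn recf "recf list" | Pr recf recf | Mn recf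

inductive reval :: "recf \<Rightarrow> nat list \<Rightarrow> nat \<Rightarrow> bool" where
  reval_Z: "reval Z xs 0"
| reval_S: "reval S (x # xs) (Suc x)"
| reval_Id: "i < length xs \<Longrightarrow> reval (Id i) xs (xs ! i)"
| reval_Cn: "length ys = length gs \<Longrightarrow> (\<forall>i < length gs. reval (gs ! i) xs (ys ! i))
             \<Longrightarrow> reval f ys z \<Longrightarrow> reval (Cn f gs) xs z"
| reval_Pr0: "reval f xs z \<Longrightarrow> reval (Pr f g) (0 # xs) z"
| reval_PrS: "reval (Pr f g) (n # xs) y \<Longrightarrow> reval g (n # y # xs) z
             \<Longrightarrow> reval (Pr f g) (Suc n # xs) z"
| reval_Mn: "reval f (n # xs) 0 \<Longrightarrow> (\<forall>m < n. \<exists>y. reval f (m # xs) y \<and> y \<noteq> 0)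
             \<Longrightarrow> reval (Mn f) xs n"

text \<open>An algebraic number is described by integer coefficients (constant term first)
  of a polynomial and a closed rational box [a,b] x [c,d] in the complex plane
  containing exactly one root of that polynomial.\<close>

type_synonym alg_desc = "int list \<times> rat \<times> rat \<times> rat \<times> rat"

definition poly_of_coeffs :: "int list \<Rightarrow> complex \<Rightarrow> complex" where
  "poly_of_coeffs cs z = (\<Sum>i<length cs. of_int (cs ! i) * z ^ i)"

definition in_box :: "alg_desc \<Rightarrow> complex \<Rightarrow> bool" where
  "in_box e z = (case e of (cs, a, b, c, d) \<Rightarrow>
     of_rat a \<le> Re z \<and> Re z \<le> of_rat b \<and> of_rat c \<le> Im z \<and> Im z \<le> of_rat d)"

definition valid_alg :: "alg_desc \<Rightarrow> bool" where
  "valid_alg e = ((\<exists>c \<in> set (fst e). c \<noteq> 0) \<and>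
                  (\<exists>!z. poly_of_coeffs (fst e) z = 0 \<and> in_box e z))"

definition alg_val :: "alg_desc \<Rightarrow> complex" where
  "alg_val e = (THE z. poly_of_coeffs (fst e) z = 0 \<and> in_box e z)"

text \<open>A transducer description.  States are 0..<nstates, input letters are
  0..<ninput, output letters are 0..<noutput; tape symbol ninput is the left end
  marker and Suc ninput is the right end marker.  trans ! a ! q ! p describes the
  matrix entry (V_a)_{qp}, outs ! a ! q is f_a(q).\<close>

datatype fst_desc = FST
  (nstates: nat) (ninput: nat) (noutput: nat) (init: nat)
  (accs: "nat list") (rejs: "nat list")
  (trans: "alg_desc list list list") (outs: "nat list list list")

definition enc_rat :: "rat \<Rightarrow> nat" where
  "enc_rat r = prod_encode (int_encode (fst (quotient_of r)), int_encode (snd (quotient_of r)))"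

definition enc_alg :: "alg_desc \<Rightarrow> nat" where
  "enc_alg e = (case e of (cs, a, b, c, d) \<Rightarrow>
     list_encode [list_encode (map int_encode cs), enc_rat a, enc_rat b, enc_rat c, enc_rat d])"

definition enc :: "fst_desc \<Rightarrow> nat" where
  "enc D = list_encode
     [nstates D, ninput D, noutput D, init D, list_encode (accs D), list_encode (rejs D),
      list_encode (map (\<lambda>A. list_encode (map (\<lambda>r. list_encode (map enc_alg r)) A)) (trans D)),
      list_encode (map (\<lambda>A. list_encode (map list_encode A)) (outs D))]"

definition Vc :: "fst_desc \<Rightarrow> nat \<Rightarrow> nat \<Rightarrow> nat \<Rightarrow> complex" where
  "Vc D a q p = alg_val (trans D ! a ! q ! p)"

definition Vr :: "fst_desc \<Rightarrow> nat \<Rightarrow> nat \<Rightarrow> nat \<Rightarrow> real" where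
  "Vr D a q p = Re (Vc D a q p)"

definition outf :: "fst_desc \<Rightarrow> nat \<Rightarrow> nat \<Rightarrow> nat list" where
  "outf D a q = outs D ! a ! q"

definition halting :: "fst_desc \<Rightarrow> nat \<Rightarrow> bool" where
  "halting D p = (p \<in> set (accs D) \<or> p \<in> set (rejs D))"

definition tape :: "fst_desc \<Rightarrow> nat list \<Rightarrow> nat list" where
  "tape D v = ninput D # v @ [Suc (ninput D)]"

text \<open>One step on tape symbol a: the weight (probability mass or amplitude) of
  configuration (p, x) after the step.  The previous output w with
  w @ f_a(q) = x is unique.\<close>

definition step :: "fst_desc \<Rightarrow> (nat \<Rightarrow> nat \<Rightarrow> nat \<Rightarrow> 'a::comm_ring_1) \<Rightarrow> nat
                    \<Rightarrow> (nat \<Rightarrow> nat list \<Rightarrow> 'a) \<Rightarrow> nat \<Rightarrow> nat list \<Rightarrow> 'a" where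
  "step D V a \<mu> p x = (\<Sum>q<nstates D.
      if length (outf D a q) \<le> length x \<and> drop (length x - length (outf D a q)) x = outf D a q
      then \<mu> q (take (length x - length (outf D a q)) x) * V a q p else 0)"

fun run :: "fst_desc \<Rightarrow> (nat \<Rightarrow> nat \<Rightarrow> nat \<Rightarrow> 'a::comm_ring_1) \<Rightarrow> nat list \<Rightarrow> nat
            \<Rightarrow> nat \<Rightarrow> nat list \<Rightarrow> 'a" where
  "run D V s 0 = (\<lambda>q x. if q = init D \<and> x = [] then 1 else 0)"
| "run D V s (Suc k) = (\<lambda>p x. if halting D p then 0 else step D V (s ! k) (run D V s k) p x)"

definition pfst_prob :: "fst_desc \<Rightarrow> nat list \<Rightarrow> nat list \<Rightarrow> real" where
  "pfst_prob D v w = (let s = tape D v in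
     \<Sum>k<length s. \<Sum>p\<in>set (accs D). step D (Vr D) (s ! k) (run D (Vr D) s k) p w)"

definition qfst_prob :: "fst_desc \<Rightarrow> nat list \<Rightarrow> nat list \<Rightarrow> real" where
  "qfst_prob D v w = (let s = tape D v in
     \<Sum>k<length s. \<Sum>p\<in>set (accs D). (cmod (step D (Vc D) (s ! k) (run D (Vc D) s k) p w))\<^sup>2)"

definition valid_common :: "fst_desc \<Rightarrow> bool" where
  "valid_common D = (0 < nstates D \<and> init D < nstates D \<and>
     set (accs D) \<subseteq> {..<nstates D} \<and> set (rejs D) \<subseteq> {..<nstates D} \<and>
     set (accs D) \<inter> set (rejs D) = {} \<and>
     length (trans D) = ninput D + 2 \<and>
     (\<forall>A \<in> set (trans D). length A = nstates D \<and>
        (\<forall>r \<in> set A. length r = nstates D \<and> (\<forall>e \<in> set r. valid_alg e))) \<and>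
     length (outs D) = ninput D + 2 \<and>
     (\<forall>A \<in> set (outs D). length A = nstates D \<and> (\<forall>ol \<in> set A. \<forall>c \<in> set ol. c < noutput D)))"

definition pfst_valid :: "fst_desc \<Rightarrow> bool" where
  "pfst_valid D = (valid_common D \<and>
     (\<forall>a < ninput D + 2. \<forall>q < nstates D. \<forall>p < nstates D.
        Im (Vc D a q p) = 0 \<and> 0 \<le> Vr D a q p) \<and>
     (\<forall>a < ninput D + 2. \<forall>q < nstates D. (\<Sum>p<nstates D. Vr D a q p) = 1) \<and>
     (\<forall>q < nstates D. \<forall>p < nstates D. \<not> halting D p \<longrightarrow> Vr D (Suc (ninput D)) q p = 0))"

definition qfst_valid :: "fst_desc \<Rightarrow> bool" where
  "qfst_valid D = (valid_common D \<and>
     (\<forall>a < ninput D + 2. \<forall>q < nstates D. \<forall>q' < nstates D.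
        (\<Sum>p<nstates D. Vc D a q p * cnj (Vc D a q' p)) = (if q = q' then 1 else 0)) \<and>
     (\<forall>q < nstates D. \<forall>p < nstates D. \<not> halting D q \<and> \<not> halting D p
        \<longrightarrow> Vc D (Suc (ninput D)) q p = 0))"

definition computes_with :: "(nat list \<Rightarrow> nat list \<Rightarrow> real) \<Rightarrow> nat \<Rightarrow> nat
     \<Rightarrow> (nat list \<times> nat list) set \<Rightarrow> real \<Rightarrow> bool" where
  "computes_with P k1 k2 R \<alpha> = (R \<subseteq> lists {..<k1} \<times> lists {..<k2} \<and>
     (\<forall>v \<in> lists {..<k1}. \<forall>w \<in> lists {..<k2}.
        ((v, w) \<in> R \<longrightarrow> P v w \<ge> \<alpha>) \<and> ((v, w) \<notin> R \<longrightarrow> P v w \<le> 1 - \<alpha>)))"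

definition pfst_computes :: "fst_desc \<Rightarrow> (nat list \<times> nat list) set \<Rightarrow> real \<Rightarrow> bool" where
  "pfst_computes D R \<alpha> = computes_with (pfst_prob D) (ninput D) (noutput D) R \<alpha>"

definition qfst_computes :: "fst_desc \<Rightarrow> (nat list \<times> nat list) set \<Rightarrow> real \<Rightarrow> bool" where
  "qfst_computes D R \<alpha> = computes_with (qfst_prob D) (ninput D) (noutput D) R \<alpha>"

definition decides_promise :: "recf \<Rightarrow> (fst_desc \<Rightarrow> bool) \<Rightarrow> (fst_desc \<Rightarrow> bool) \<Rightarrow> bool" where
  "decides_promise M Promise Answer =
     (\<forall>D. Promise D \<longrightarrow> reval M [enc D] (if Answer D then 1 else 0))"

end

theory Submission
  imports Defs "HOL-Library.Countable"
begin

text \<open>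
  A transducer that splits with weight 1/3 each into a branch emitting the tops of a sequence of
  dominoes, a branch emitting the bottoms, and rejection, assigns probability 2/3 to an output
  exactly when both branches emit it, and at most 1/3 otherwise. So emptiness is a Post
  correspondence problem, and it suffices to encode computations in dominoes.

  Evaluation of a recursive function is encoded by string rewriting: a word is a composition of
  relations on stacks of numbers (rightmost symbol first), every rule \<open>l \<rightarrow> r\<close>
  satisfies \<open>sem r \<subseteq> sem l\<close>, so rewriting is sound for trivial reasons and only completeness needs
  an induction over evaluations.

  Undecidability follows by diagonalisation without a universal function: given a would-be
  decider \<open>M\<close>, let \<open>F\<close> map the numbers describing the dominoes of a program to \<open>M\<close> applied to the code of
  the transducer that runs this program on these very numbers, and apply \<open>F\<close> to its own dominoes.
\<close>

section \<open>Recursive functions\<close>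

lemma reval_deterministic:
  assumes "reval f xs y" and "reval f xs z"
  shows "y = z"
  using assms
proof (induction arbitrary: z rule: reval.induct)
  case (reval_Cn ys gs xs f y)
  from reval_Cn.prems obtain ys' where ys':
    "length ys' = length gs" "\<forall>i<length gs. reval (gs ! i) xs (ys' ! i)" "reval f ys' z"
    by (cases rule: reval.cases) blast
  have "ys = ys'"
    using reval_Cn.hyps(1) reval_Cn.IH(1) ys'(1,2) by (intro nth_equalityI) auto
  then show ?case using reval_Cn.IH(2) ys'(3) by blast
next
  case (reval_PrS f g n xs y y')
  from reval_PrS.prems obtain u where "reval (Pr f g) (n # xs) u" "reval g (n # u # xs) z"
    by (cases rule: reval.cases) auto
  then show ?case using reval_PrS.IH by blast
next
  case (reval_Mn f n xs)
  from reval_Mn.prems have z: "reval f (z # xs) 0"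
      "\<forall>m<z. \<exists>y. reval f (m # xs) y \<and> y \<noteq> 0"
    by (cases rule: reval.cases, blast)+
  \<comment> \<open>Were \<open>n\<close> and \<open>z\<close> different, the value of
    \<open>f\<close> at the smaller one would be both zero and nonzero.\<close>
  show ?case
    using reval_Mn.IH z by (metis linorder_neqE_nat)
next
  case (reval_Id i xs)
  from reval_Id.prems show ?case by (cases rule: reval.cases) auto
next
  case (reval_Pr0 f xs y g)
  from reval_Pr0.prems show ?case by (cases rule: reval.cases) (auto intro: reval_Pr0.IH)
next
  case (reval_Z xs)
  then show ?case by (cases rule: reval.cases) auto
next
  case (reval_S x xs)
  then show ?case by (cases rule: reval.cases) auto
qed

section \<open>Closure properties of total computable functions\<close>

definition computable :: "nat \<Rightarrow> (nat list \<Rightarrow> nat) \<Rightarrow> bool" where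
  "computable n g \<longleftrightarrow> (\<exists>e. \<forall>xs. length xs = n \<longrightarrow> reval e xs (g xs))"

lemma computable_nth: "i < n \<Longrightarrow> computable n (\<lambda>xs. xs ! i)"
  unfolding computable_def using reval_Id by blast

lemma computable_compose1:
  assumes "computable 1 (\<lambda>ys. h (ys ! 0))" and "computable n f"
  shows "computable n (\<lambda>xs. h (f xs))"
proof -
  from assms obtain eh ef where "\<And>ys. length ys = 1 \<Longrightarrow> reval eh ys (h (ys ! 0))"
    "\<And>xs. length xs = n \<Longrightarrow> reval ef xs (f xs)"
    unfolding computable_def by blast
  then have "length xs = n \<Longrightarrow> reval (Cn eh [ef]) xs (h (f xs))" for xs
    using reval_Cn[of "[f xs]" "[ef]" xs eh] by (metis One_nat_def less_one length_Cons list.size(3) nth_Cons_0)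
  then show ?thesis unfolding computable_def by blast
qed

lemma computable_Suc:
  assumes "computable n f"
  shows "computable n (\<lambda>xs. Suc (f xs))"
proof (rule computable_compose1[OF _ assms])
  have "length ys = 1 \<Longrightarrow> reval S ys (Suc (ys ! 0))" for ys
    by (cases ys) (auto intro: reval_S)
  then show "computable 1 (\<lambda>ys. Suc (ys ! 0))" unfolding computable_def by blast
qed

lemma computable_const: "computable n (\<lambda>xs. c)"
proof (induction c)
  case 0
  then show ?case unfolding computable_def using reval_Z by blast
next
  case (Suc c)
  then show ?case by (rule computable_Suc)
qed

lemma computable_rec_nat:
  assumes h: "computable 2 (\<lambda>ys. h (ys ! 0) (ys ! 1))" and f: "computable n f" and g: "computable n g"
  shows "computable n (\<lambda>xs. rec_nat (g xs) h (f xs))"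
proof -
  from h obtain eh where eh: "\<And>ys. length ys = 2 \<Longrightarrow> reval eh ys (h (ys ! 0) (ys ! 1))"
    unfolding computable_def by blast
  from f obtain ef where ef: "\<And>xs. length xs = n \<Longrightarrow> reval ef xs (f xs)"
    unfolding computable_def by blast
  from g obtain eg where eg: "\<And>xs. length xs = n \<Longrightarrow> reval eg xs (g xs)"
    unfolding computable_def by blast
  \<comment> \<open>\<open>Pr\<close> hands its step function the counter, the previous value and
    then the parameters. Here the only parameter is the initial value, which the two projections
    discard.\<close>
  let ?step = "Cn eh [Id 0, Id (Suc 0)]"
  have Id: "reval (Id 0) (x # xs) x" "reval (Id (Suc 0)) (x # y # xs) y" for x y xs
    using reval_Id[of 0 "x # xs"] reval_Id[of 1 "x # y # xs"] by auto
  have step: "reval ?step (k # y # xs) (h k y)" for k y xs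
    using eh[of "[k, y]"] Id by (intro reval_Cn[where ys = "[k, y]"]) (auto simp: less_Suc_eq)
  have pr: "reval (Pr (Id 0) ?step) (k # [y]) (rec_nat y h k)" for k y
    by (induction k) (auto intro: reval_Pr0 reval_PrS step Id)
  have "reval (Cn (Pr (Id 0) ?step) [ef, eg]) xs (rec_nat (g xs) h (f xs))" if "length xs = n" for xs
    using pr ef[OF that] eg[OF that]
    by (intro reval_Cn[where ys = "[f xs, g xs]"]) (auto simp: less_Suc_eq)
  then show ?thesis unfolding computable_def by blast
qed

lemma computable_funpow:
  assumes "computable 1 (\<lambda>ys. h (ys ! 0))" and "computable n f" and "computable n g"
  shows "computable n (\<lambda>xs. (h ^^ f xs) (g xs))"
proof -
  have "computable 2 (\<lambda>ys. h (ys ! 1))"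
    by (rule computable_compose1[OF assms(1)]) (simp add: computable_nth)
  then have "computable n (\<lambda>xs. rec_nat (g xs) (\<lambda>_. h) (f xs))"
    by (rule computable_rec_nat[OF _ assms(2,3)])
  moreover have "rec_nat y (\<lambda>_. h) k = (h ^^ k) y" for y k
    by (induction k) auto
  ultimately show ?thesis by simp
qed

lemma computable_add:
  assumes "computable n f" and "computable n g"
  shows "computable n (\<lambda>xs. f xs + g xs)"
proof -
  have "computable n (\<lambda>xs. (Suc ^^ f xs) (g xs))"
    by (intro computable_funpow computable_Suc computable_nth assms) simp
  then show ?thesis by simp
qed

text \<open>The Cantor pairing of \<open>m\<close> and \<open>n\<close> is
  \<open>triangle (m + n) + m\<close>, and a triangular number is an iterated sum.\<close>

lemma computable_prod_encode:
  assumes "computable n f" and "computable n g"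
  shows "computable n (\<lambda>xs. prod_encode (f xs, g xs))"
proof -
  have "rec_nat 0 (\<lambda>k y. y + Suc k) m = triangle m" for m
    by (induction m) (auto simp: triangle_Suc)
  moreover have "computable n (\<lambda>xs. rec_nat 0 (\<lambda>k y. y + Suc k) (f xs + g xs) + f xs)"
    by (intro computable_add computable_rec_nat computable_Suc computable_nth computable_const assms) simp_all
  ultimately show ?thesis by (simp add: prod_encode_def)
qed

section \<open>String rewriting on stack programs\<close>

inductive rewrite_step :: "('a list \<times> 'a list) set \<Rightarrow> 'a list \<Rightarrow> 'a list \<Rightarrow> bool" for R where
  "(l, r) \<in> R \<Longrightarrow> rewrite_step R (u @ l @ v) (u @ r @ v)"

abbreviation rewrites_to :: "('a list \<times> 'a list) set \<Rightarrow> 'a list \<Rightarrow> 'a list \<Rightarrow> bool" where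
  "rewrites_to R \<equiv> (rewrite_step R)\<^sup>*\<^sup>*"

lemma rewrites_context: "rewrites_to R x y \<Longrightarrow> rewrites_to R (u @ x @ v) (u @ y @ v)"
proof (induction rule: rtranclp_induct)
  case (step y z)
  from step.hyps(2) have "rewrite_step R (u @ y @ v) (u @ z @ v)"
  proof cases
    case (1 l r u' v')
    then show ?thesis using rewrite_step.intros[of l r R "u @ u'" "v' @ v"] by simp
  qed
  with step.IH show ?case by (rule rtranclp.rtrancl_into_rtrancl)
qed simp

lemma rewrites_rule: "(l, r) \<in> R \<Longrightarrow> rewrites_to R (l @ v) (r @ v)"
  using rewrite_step.intros[of l r R "[]" v] by auto

lemma rewrites_right: "rewrites_to R x y \<Longrightarrow> rewrites_to R (u @ x) (u @ y)"
  using rewrites_context[of R x y u "[]"] by simp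

lemma rewrites_Cons: "rewrites_to R x y \<Longrightarrow> rewrites_to R (a # x) (a # y)"
  using rewrites_right[of R x y "[a]"] by simp

text \<open>Numbers are spelled with \<open>Inc\<close> and \<open>Zero\<close>, and a rule sees
  only their first letters. \<open>Inc2\<close>, \<open>Reset\<close> and \<open>Ins\<close> carry
  the unfinished effect of \<open>Drop2\<close>, \<open>Swap\<close> and \<open>Copy\<close> past a
  number letter by letter. \<open>Loop\<close> and \<open>Branch\<close> are the two phases of an
  unbounded search, and \<open>Hash\<close> separates configurations.\<close>

datatype sym = Hash | Zero | Inc | Yes | Start | Inc2 | Drop2 | Reset | Ins | Swap | Test
  | Copy nat | Call recf nat | Loop recf nat | Branch recf nat

text \<open>The state of a minimisation resumed at counter \<open>k\<close>; for
  \<open>k = 0\<close> it amounts to the premises of \<open>reval_Mn\<close>.\<close>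

definition loops_to :: "recf \<Rightarrow> nat \<Rightarrow> nat list \<Rightarrow> nat \<Rightarrow> bool" where
  "loops_to f k xs z \<longleftrightarrow> k \<le> z \<and> reval f (z # xs) 0 \<and>
     (\<forall>i. k \<le> i \<and> i < z \<longrightarrow> (\<exists>y. reval f (i # xs) y \<and> y \<noteq> 0))"

text \<open>\<open>Branch\<close> trusts the number \<open>y\<close> on top to be the value of
  \<open>f\<close> at the counter \<open>k\<close> below it and denotes the rest of the
  search.\<close>

fun sem :: "recf \<Rightarrow> nat \<Rightarrow> sym \<Rightarrow> nat list \<Rightarrow> nat list \<Rightarrow> bool" where
  "sem F n Hash s t = False"
| "sem F n Zero s t = (t = 0 # s)"
| "sem F n Inc s t = (\<exists>x r. s = x # r \<and> t = Suc x # r)"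
| "sem F n Yes s t = (t = s)"
| "sem F n Start s t = (n \<le> length s \<and> t = drop n s \<and> reval F (take n s) 1)"
| "sem F n Inc2 s t = (\<exists>x y r. s = x # y # r \<and> t = x # Suc y # r)"
| "sem F n Drop2 s t = (\<exists>x y r. s = x # y # r \<and> t = x # r)"
| "sem F n Reset s t = (\<exists>x r. s = x # r \<and> t = 0 # r)"
| "sem F n Ins s t = (\<exists>x r. s = x # r \<and> t = x # 0 # r)"
| "sem F n Swap s t = (\<exists>x y r. s = x # y # r \<and> t = y # x # r)"
| "sem F n Test s t = (s = 1 # t)"
| "sem F n (Copy k) s t = (k < length s \<and> t = s ! k # s)"
| "sem F n (Call f m) s t = (m \<le> length s \<and> (\<exists>z. reval f (take m s) z \<and> t = z # drop m s))"
| "sem F n (Loop f m) s t = (\<exists>k r. s = k # r \<and> m \<le> length r \<and>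
     (\<exists>z. loops_to f k (take m r) z \<and> t = z # drop m r))"
| "sem F n (Branch f m) s t = (\<exists>y k r. s = y # k # r \<and> m \<le> length r \<and>
     (if y = 0 then t = k # drop m r
      else \<exists>z. loops_to f (Suc k) (take m r) z \<and> t = z # drop m r))"

fun word_sem :: "recf \<Rightarrow> nat \<Rightarrow> sym list \<Rightarrow> nat list \<Rightarrow> nat list \<Rightarrow> bool" where
  "word_sem F n [] s t = (t = s)"
| "word_sem F n (a # w) s t = (\<exists>m. word_sem F n w s m \<and> sem F n a m t)"

lemma word_sem_append:
  "word_sem F n (u @ w) s t \<longleftrightarrow> (\<exists>m. word_sem F n w s m \<and> word_sem F n u m t)"
  by (induction u arbitrary: t) auto

text \<open>Evaluates the last function first, so that the values end up in order on top of the
  argument frame, which lies below the \<open>length gs\<close> values already computed. For \<open>m = 0\<close> nothing is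
  copied and the truncated index is irrelevant.\<close>

fun args_word :: "nat \<Rightarrow> recf list \<Rightarrow> sym list" where
  "args_word m [] = []"
| "args_word m (g # gs) = Call g m # replicate m (Copy (length gs + m - 1)) @ args_word m gs"

text \<open>Operations move rightwards past, or absorb, the letters that build their arguments. For
  instance, pushing 0 and then swapping amounts to inserting 0 below the top, so
  \<open>[Swap, Zero]\<close> becomes \<open>[Ins]\<close>.\<close>

definition stack_rules :: "(sym list \<times> sym list) set" where
  "stack_rules =
    {([Inc2, Inc], [Inc, Inc2]), ([Inc2, Zero], [Zero, Inc]),
     ([Drop2, Inc], [Inc, Drop2]), ([Drop2, Zero], [Reset]),
     ([Reset, Inc], [Reset]), ([Reset, Zero], [Zero]),
     ([Ins, Inc], [Inc, Ins]), ([Ins, Zero], [Zero, Zero]),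
     ([Swap, Inc], [Inc2, Swap]), ([Swap, Zero], [Ins]),
     ([Test, Inc, Zero], [Yes])}"

fun copy_rules :: "nat \<Rightarrow> (sym list \<times> sym list) set" where
  "copy_rules 0 = {([Copy 0, Inc], [Inc2, Inc, Copy 0]), ([Copy 0, Zero], [Zero, Zero])}"
| "copy_rules (Suc k) = {([Copy (Suc k), Inc], [Inc2, Copy (Suc k)]),
     ([Copy (Suc k), Zero], [Ins, Copy k])} \<union> copy_rules k"

text \<open>Since the arity is part of each \<open>Call\<close> symbol, recursion over the program
  yields finitely many rules. In the recursion step of \<open>Pr\<close>, removing the
  \<open>Inc\<close> leaves \<open>n\<close> on top. The frame is copied for the inner call, and
  \<open>Swap\<close> puts the value of that call below \<open>n\<close>, where \<open>g\<close>
  expects it.\<close>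

fun call_rules :: "recf \<Rightarrow> nat \<Rightarrow> (sym list \<times> sym list) set" where
  "call_rules Z m = {([Call Z m], replicate m Drop2 @ [Zero])}"
| "call_rules S m = (if m = 0 then {} else {([Call S m], Inc # replicate (m - 1) Drop2)})"
| "call_rules (Id i) m = (if i < m then {([Call (Id i) m], replicate m Drop2 @ [Copy i])} else {})
     \<union> copy_rules i"
| "call_rules (Cn f gs) m =
     {([Call (Cn f gs) m], replicate m Drop2 @ Call f (length gs) # args_word m gs)}
     \<union> copy_rules (length gs + m) \<union> call_rules f (length gs) \<union> (\<Union>g\<in>set gs. call_rules g m)"
| "call_rules (Pr f g) m = (case m of 0 \<Rightarrow> {} | Suc k \<Rightarrow>
     {([Call (Pr f g) m, Zero], [Call f k]),
      ([Call (Pr f g) m, Inc],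
       [Call g (Suc m), Swap, Call (Pr f g) m] @ replicate m (Copy k))}
     \<union> copy_rules k \<union> call_rules f k \<union> call_rules g (Suc m))"
| "call_rules (Mn f) m =
     {([Call (Mn f) m], [Loop f m, Zero]),
      ([Loop f m], [Branch f m, Call f (Suc m)] @ replicate (Suc m) (Copy m)),
      ([Branch f m, Zero], replicate m Drop2 @ [Drop2, Swap, Zero]),
      ([Branch f m, Inc], [Loop f m, Inc, Drop2, Swap])}
     \<union> copy_rules m \<union> call_rules f (Suc m)"

definition program_rules :: "recf \<Rightarrow> nat \<Rightarrow> (sym list \<times> sym list) set" where
  "program_rules F n = insert ([Start], [Test, Call F n]) (stack_rules \<union> call_rules F n)"

lemma finite_copy_rules: "finite (copy_rules k)"
  by (induction k) auto

lemma finite_call_rules: "finite (call_rules f m)"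
  by (induction f m rule: call_rules.induct) (auto simp: finite_copy_rules split: nat.split)

lemma finite_program_rules: "finite (program_rules F n)"
  by (simp add: program_rules_def stack_rules_def finite_call_rules)

section \<open>Soundness\<close>

definition sound_rule :: "recf \<Rightarrow> nat \<Rightarrow> sym list \<times> sym list \<Rightarrow> bool" where
  "sound_rule F n lr \<longleftrightarrow>
     (\<forall>s t. word_sem F n (snd lr) s t \<longrightarrow> word_sem F n (fst lr) s t)"

lemma word_sem_Drop2:
  "word_sem F n (replicate m Drop2) (z # s) t \<longleftrightarrow> m \<le> length s \<and> t = z # drop m s"
proof (induction m arbitrary: t)
  case (Suc m)
  show ?case
  proof (cases "drop m s")
    case Nil
    then show ?thesis using Suc by auto
  next
    case (Cons y r)
    then have "m < length s" by (metis drop_eq_Nil leI list.discI)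
    moreover have "drop (Suc m) s = r" using Cons by (metis drop_Suc list.sel(3) tl_drop)
    ultimately show ?thesis using Suc Cons by auto
  qed
qed auto

text \<open>Every copy shifts the stack by one, so the constant index \<open>k\<close> visits the
  positions \<open>k\<close>, \<open>k - 1\<close> and so on of the original stack, and the copied
  block keeps its order.\<close>

lemma word_sem_Copy:
  assumes "word_sem F n (replicate i (Copy k)) s t" and "i \<le> Suc k"
  shows "i = 0 \<and> t = s \<or> k < length s \<and> t = drop (Suc k - i) (take (Suc k) s) @ s"
  using assms
proof (induction i arbitrary: t)
  case (Suc i)
  then obtain m where m: "word_sem F n (replicate i (Copy k)) s m" "k < length m" "t = m ! k # m"
    by auto
  from Suc.IH[OF m(1)] Suc.prems(2) consider "i = 0" "m = s"
    | "k < length s" "m = drop (Suc k - i) (take (Suc k) s) @ s" by fastforce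
  then show ?case
  proof cases
    case 1
    then show ?thesis using m by (simp add: take_Suc_conv_app_nth)
  next
    case 2
    have "m ! k = s ! (k - i)" using 2 Suc.prems(2) by (simp add: nth_append)
    moreover have "drop (k - i) (take (Suc k) s) = s ! (k - i) # drop (Suc k - i) (take (Suc k) s)"
      using 2 Suc.prems(2) by (subst Cons_nth_drop_Suc[symmetric]) (auto simp: Suc_diff_le)
    ultimately show ?thesis using 2 m by simp
  qed
qed auto

lemma word_sem_copy_frame:
  assumes "word_sem F n (replicate m (Copy (j + m - 1))) (ys @ s) t" and "length ys = j"
  shows "m \<le> length s \<and> t = take m s @ ys @ s \<or> m = 0 \<and> t = ys @ s"
proof (cases m)
  case (Suc k)
  then show ?thesis using word_sem_Copy[OF assms(1)] assms(2) by auto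
qed (use assms in auto)

lemma word_sem_args_word:
  assumes "word_sem F n (args_word m gs) s t"
  shows "\<exists>ys. length ys = length gs \<and> t = ys @ s \<and>
    (\<forall>i<length gs. reval (gs ! i) (take m s) (ys ! i))"
  using assms
proof (induction gs arbitrary: t)
  case (Cons g gs)
  then obtain u v where u: "word_sem F n (args_word m gs) s u"
      and v: "word_sem F n (replicate m (Copy (length gs + m - 1))) u v"
      and t: "sem F n (Call g m) v t"
    by (auto simp: word_sem_append)
  from Cons.IH[OF u] obtain ys where ys: "length ys = length gs" "u = ys @ s"
    "\<forall>i<length gs. reval (gs ! i) (take m s) (ys ! i)" by blast
  from t obtain z where "reval g (take m v) z" "t = z # drop m v" by auto
  with word_sem_copy_frame[OF v[unfolded ys(2)] ys(1)] ys
  have "reval g (take m s) z" "t = z # ys @ s" by (auto simp: min_def)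
  with ys show ?case
    by (intro exI[of _ "z # ys"]) (auto simp: nth_Cons split: nat.split)
qed auto

lemma sound_stack_rules: "lr \<in> stack_rules \<Longrightarrow> sound_rule F n lr"
  unfolding stack_rules_def sound_rule_def by (auto simp: Cons_eq_append_conv)

lemma sound_copy_rules: "lr \<in> copy_rules k \<Longrightarrow> sound_rule F n lr"
  by (induction k) (auto simp: sound_rule_def)

lemma loops_to_Suc:
  "reval f (k # xs) y \<Longrightarrow> y \<noteq> 0 \<Longrightarrow> loops_to f (Suc k) xs z \<Longrightarrow> loops_to f k xs z"
  unfolding loops_to_def by (metis Suc_leD Suc_leI le_neq_implies_less)

lemma loops_to_refl: "reval f (k # xs) 0 \<Longrightarrow> loops_to f k xs k"
  unfolding loops_to_def by simp

lemma sound_call_rules: "lr \<in> call_rules f m \<Longrightarrow> sound_rule F n lr"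
proof (induction f m rule: call_rules.induct)
  case (1 m)
  then show ?case
    by (auto simp: sound_rule_def word_sem_append word_sem_Drop2 intro: reval_Z)
next
  case (2 m)
  show ?case
  proof (cases m)
    case (Suc k)
    have "sem F n (Call S m) s t" if "word_sem F n (Inc # replicate k Drop2) s t" for s t
    proof (cases s)
      case Nil
      \<comment> \<open>The symbol executed first, \<open>Drop2\<close> or for \<open>k = 0\<close>
        the \<open>Inc\<close>, already fails on an empty stack.\<close>
      with that show ?thesis by (cases k) (auto simp: replicate_append_same[symmetric] word_sem_append)
    next
      case (Cons x r)
      with that show ?thesis by (auto simp: Suc word_sem_Drop2 intro: reval_S)
    qed
    with 2 Suc show ?thesis by (auto simp: sound_rule_def)
  qed (use 2 in auto)
next
  case (3 i m)
  have "sound_rule F n ([Call (Id i) m], replicate m Drop2 @ [Copy i])" if "i < m"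
    using that reval_Id[of i]
    by (auto simp: sound_rule_def word_sem_append word_sem_Drop2) (metis length_take min.absorb2 nth_take)
  with 3 show ?case by (auto split: if_splits intro: sound_copy_rules)
next
  case (4 f gs m)
  have "sem F n (Call (Cn f gs) m) s t"
    if w: "word_sem F n (replicate m Drop2 @ Call f (length gs) # args_word m gs) s t" for s t
  proof -
    from w obtain u v where u: "word_sem F n (args_word m gs) s u"
      and v: "sem F n (Call f (length gs)) u v" and t: "word_sem F n (replicate m Drop2) v t"
      by (auto simp: word_sem_append)
    from word_sem_args_word[OF u] obtain ys where ys: "length ys = length gs" "u = ys @ s"
      "\<forall>i<length gs. reval (gs ! i) (take m s) (ys ! i)" by blast
    from v ys obtain z where "reval f ys z" "v = z # s" by auto
    \<comment> \<open>For empty \<open>gs\<close> the argument word does not inspect the frame; that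
      the stack has \<open>m\<close> entries then follows from the \<open>Drop2\<close>
      symbols.\<close>
    with t ys show ?thesis by (auto simp: word_sem_Drop2 intro: reval_Cn)
  qed
  then have "sound_rule F n ([Call (Cn f gs) m], replicate m Drop2 @ Call f (length gs) # args_word m gs)"
    by (auto simp: sound_rule_def)
  with 4 show ?case by (auto intro: sound_copy_rules)
next
  case (5 f g m)
  show ?case
  proof (cases m)
    case (Suc k)
    have 1: "sound_rule F n ([Call (Pr f g) m, Zero], [Call f k])"
      by (auto simp: sound_rule_def Suc intro: reval_Pr0)
    have "word_sem F n [Call (Pr f g) m, Inc] s t"
      if w: "word_sem F n ([Call g (Suc m), Swap, Call (Pr f g) m] @ replicate m (Copy k)) s t" for s t
    proof -
      from w obtain u where u: "word_sem F n (replicate m (Copy k)) s u"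
        and v: "word_sem F n [Call g (Suc m), Swap, Call (Pr f g) m] u t"
        unfolding word_sem_append by blast
      from word_sem_copy_frame[of F n m 0 "[]" s u] u Suc
      have s: "m \<le> length s" "u = take m s @ s" by auto
      then obtain x r where r: "s = x # r" by (cases s) (auto simp: Suc)
      from v s obtain y where y: "reval (Pr f g) (take m s) y"
        "word_sem F n [Call g (Suc m), Swap] (y # s) t" by auto
      from y(2) r Suc obtain z where "reval g (x # y # take k r) z" "t = z # drop k r" by auto
      with y(1) r Suc s(1) show ?thesis by (auto intro: reval_PrS)
    qed
    then have "sound_rule F n ([Call (Pr f g) m, Inc], [Call g (Suc m), Swap, Call (Pr f g) m] @ replicate m (Copy k))"
      by (simp add: sound_rule_def)
    with 1 5 Suc show ?thesis by (auto intro: sound_copy_rules)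
  qed (use 5 in auto)
next
  case (6 f m)
  have 1: "sound_rule F n ([Call (Mn f) m], [Loop f m, Zero])"
    by (auto simp: sound_rule_def loops_to_def intro!: reval_Mn)
  have "word_sem F n [Loop f m] s t"
    if w: "word_sem F n ([Branch f m, Call f (Suc m)] @ replicate (Suc m) (Copy m)) s t" for s t
  proof -
    from w obtain u where u: "word_sem F n (replicate (Suc m) (Copy m)) s u"
      and v: "word_sem F n [Branch f m, Call f (Suc m)] u t"
      unfolding word_sem_append by blast
    from word_sem_copy_frame[of F n "Suc m" 0 "[]" s u] u
    have s: "Suc m \<le> length s" "u = take (Suc m) s @ s" by auto
    then obtain k r where r: "s = k # r" by (cases s) auto
    from v s r obtain y where "reval f (k # take m r) y" "sem F n (Branch f m) (y # k # r) t" by auto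
    with r s(1) show ?thesis by (auto split: if_splits intro: loops_to_refl loops_to_Suc)
  qed
  then have 2: "sound_rule F n ([Loop f m], [Branch f m, Call f (Suc m)] @ replicate (Suc m) (Copy m))"
    by (simp add: sound_rule_def)
  have 3: "sound_rule F n ([Branch f m, Zero], replicate m Drop2 @ [Drop2, Swap, Zero])"
    by (auto simp: sound_rule_def word_sem_append word_sem_Drop2)
  have 4: "sound_rule F n ([Branch f m, Inc], [Loop f m, Inc, Drop2, Swap])"
    by (auto simp: sound_rule_def)
  from 1 2 3 4 6 show ?case by (auto intro: sound_copy_rules)
qed

lemma sound_program_rules: "lr \<in> program_rules F n \<Longrightarrow> sound_rule F n lr"
  unfolding program_rules_def
  by (auto intro: sound_stack_rules sound_call_rules) (auto simp: sound_rule_def)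

text \<open>Along a derivation the denoted relation can only shrink, so whatever the last word
  relates is already related by the first.\<close>

lemma word_sem_rewrites:
  assumes "rewrites_to (program_rules F n) u w" and "word_sem F n w s t"
  shows "word_sem F n u s t"
  using assms
proof (induction rule: converse_rtranclp_induct)
  case (step u v)
  from step.hyps(1) step.IH[OF step.prems] show ?case
    by cases (use sound_program_rules in \<open>fastforce simp: word_sem_append sound_rule_def\<close>)
qed simp

section \<open>Words for numbers and argument frames\<close>

definition num :: "nat \<Rightarrow> sym list" where
  "num x = replicate x Inc @ [Zero]"

definition frame :: "nat list \<Rightarrow> sym list" where
  "frame xs = concat (map num xs)"

lemma num_simps [simp]: "num 0 = [Zero]" "num (Suc x) = Inc # num x"
  by (simp_all add: num_def)

lemma frame_simps [simp]: "frame [] = []" "frame (x # xs) = num x @ frame xs"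
    "frame (xs @ ys) = frame xs @ frame ys"
  by (simp_all add: frame_def)

lemma word_sem_num: "word_sem F n (num x) s t \<longleftrightarrow> t = x # s"
  by (induction x arbitrary: t) auto

lemma word_sem_frame: "word_sem F n (frame xs) s t \<longleftrightarrow> t = xs @ s"
  by (induction xs arbitrary: t) (auto simp: word_sem_append word_sem_num)

text \<open>\<open>Yes\<close> denotes the identity, so the start word relates the empty stack to
  itself. Whatever stack \<open>w\<close> leaves, \<open>frame xs\<close> pushes the arguments on
  top of it, and \<open>Start\<close> then demands \<open>reval F xs 1\<close>.\<close>

lemma program_sound:
  assumes "rewrites_to (program_rules F (length xs)) (Start # frame xs @ w) [Yes]"
  shows "reval F xs 1"
  using word_sem_rewrites[OF assms, of "[]" "[]"]
  by (auto simp: word_sem_append word_sem_frame)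

section \<open>Completeness of the rewriting system\<close>

lemma rewrites_Inc2:
  assumes "stack_rules \<subseteq> R"
  shows "rewrites_to R (Inc2 # num x @ num y @ w) (num x @ num (Suc y) @ w)"
proof (induction x)
  case 0
  then show ?case
    using rewrites_rule[of "[Inc2, Zero]" "[Zero, Inc]" R "num y @ w"] assms
    by (auto simp: stack_rules_def)
next
  case (Suc x)
  have "rewrites_to R (Inc2 # num (Suc x) @ num y @ w) (Inc # Inc2 # num x @ num y @ w)"
    using rewrites_rule[of "[Inc2, Inc]" "[Inc, Inc2]" R] assms
    by (auto simp: stack_rules_def)
  also have "rewrites_to R \<dots> (Inc # num x @ num (Suc y) @ w)"
    by (rule rewrites_Cons) (rule Suc)
  finally show ?case by simp
qed

lemma rewrites_Reset:
  assumes "stack_rules \<subseteq> R"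
  shows "rewrites_to R (Reset # num x @ w) (Zero # w)"
proof (induction x)
  case 0
  then show ?case
    using rewrites_rule[of "[Reset, Zero]" "[Zero]" R] assms by (auto simp: stack_rules_def)
next
  case (Suc x)
  have "rewrites_to R (Reset # num (Suc x) @ w) (Reset # num x @ w)"
    using rewrites_rule[of "[Reset, Inc]" "[Reset]" R] assms by (auto simp: stack_rules_def)
  also note Suc
  finally show ?case .
qed

lemma rewrites_Drop2:
  assumes "stack_rules \<subseteq> R"
  shows "rewrites_to R (Drop2 # num x @ num y @ w) (num x @ w)"
proof (induction x)
  case 0
  have "rewrites_to R (Drop2 # num 0 @ num y @ w) (Reset # num y @ w)"
    using rewrites_rule[of "[Drop2, Zero]" "[Reset]" R] assms by (auto simp: stack_rules_def)
  also note rewrites_Reset[OF assms]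
  finally show ?case by simp
next
  case (Suc x)
  have "rewrites_to R (Drop2 # num (Suc x) @ num y @ w) (Inc # Drop2 # num x @ num y @ w)"
    using rewrites_rule[of "[Drop2, Inc]" "[Inc, Drop2]" R] assms by (auto simp: stack_rules_def)
  also have "rewrites_to R \<dots> (Inc # num x @ w)"
    by (rule rewrites_Cons) (rule Suc)
  finally show ?case by simp
qed

lemma rewrites_Ins:
  assumes "stack_rules \<subseteq> R"
  shows "rewrites_to R (Ins # num x @ w) (num x @ num 0 @ w)"
proof (induction x)
  case 0
  then show ?case
    using rewrites_rule[of "[Ins, Zero]" "[Zero, Zero]" R] assms by (auto simp: stack_rules_def)
next
  case (Suc x)
  have "rewrites_to R (Ins # num (Suc x) @ w) (Inc # Ins # num x @ w)"
    using rewrites_rule[of "[Ins, Inc]" "[Inc, Ins]" R] assms by (auto simp: stack_rules_def)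
  also have "rewrites_to R \<dots> (Inc # num x @ num 0 @ w)"
    by (rule rewrites_Cons) (rule Suc)
  finally show ?case by simp
qed

lemma rewrites_Swap:
  assumes "stack_rules \<subseteq> R"
  shows "rewrites_to R (Swap # num x @ num y @ w) (num y @ num x @ w)"
proof (induction x)
  case 0
  have "rewrites_to R (Swap # num 0 @ num y @ w) (Ins # num y @ w)"
    using rewrites_rule[of "[Swap, Zero]" "[Ins]" R] assms by (auto simp: stack_rules_def)
  also note rewrites_Ins[OF assms]
  finally show ?case by simp
next
  case (Suc x)
  have "rewrites_to R (Swap # num (Suc x) @ num y @ w) (Inc2 # Swap # num x @ num y @ w)"
    using rewrites_rule[of "[Swap, Inc]" "[Inc2, Swap]" R] assms by (auto simp: stack_rules_def)
  also have "rewrites_to R \<dots> (Inc2 # num y @ num x @ w)"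
    by (rule rewrites_Cons) (rule Suc)
  also note rewrites_Inc2[OF assms]
  finally show ?case .
qed

text \<open>Numbers above the wanted entry are dissolved letter by letter and rebuilt below the
  copy, \<open>Inc\<close> turning into \<open>Inc2\<close> and \<open>Zero\<close> into
  \<open>Ins\<close>. Hence an induction on the top number inside the induction on the
  depth.\<close>

lemma rewrites_Copy:
  assumes "stack_rules \<subseteq> R" and "copy_rules K \<subseteq> R" and "k \<le> K" and "k < length xs"
  shows "rewrites_to R (Copy k # frame xs @ w) (num (xs ! k) @ frame xs @ w)"
proof -
  have copy: "copy_rules k \<subseteq> R"
    using assms(3,2) by (induction rule: inc_induct) auto
  show ?thesis using copy assms(4)
  proof (induction k arbitrary: xs)
    case 0
    then obtain x ys where xs: "xs = x # ys" by (cases xs) auto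
    have "rewrites_to R (Copy 0 # num x @ v) (num x @ num x @ v)" for v
    proof (induction x)
      case 0
      show ?case
        using rewrites_rule[of "[Copy 0, Zero]" "[Zero, Zero]" R] \<open>copy_rules 0 \<subseteq> R\<close> by simp
    next
      case (Suc x)
      \<comment> \<open>At depth 0 each \<open>Inc\<close> is doubled: \<open>Inc\<close> for the
        copy on top, \<open>Inc2\<close> for the original below it.\<close>
      have "rewrites_to R (Copy 0 # num (Suc x) @ v) (Inc2 # Inc # Copy 0 # num x @ v)"
        using rewrites_rule[of "[Copy 0, Inc]" "[Inc2, Inc, Copy 0]" R] \<open>copy_rules 0 \<subseteq> R\<close> by simp
      also have "rewrites_to R \<dots> (Inc2 # Inc # num x @ num x @ v)"
        by (intro rewrites_Cons Suc)
      also have "rewrites_to R \<dots> (num (Suc x) @ num (Suc x) @ v)"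
        using rewrites_Inc2[OF assms(1), of "Suc x" x v] by simp
      finally show ?case .
    qed
    then show ?case by (simp add: xs)
  next
    case (Suc k)
    then obtain x ys where xs: "xs = x # ys" and k: "k < length ys" by (cases xs) auto
    let ?z = "ys ! k"
    have "rewrites_to R (Copy (Suc k) # num x @ frame ys @ w) (num ?z @ num x @ frame ys @ w)"
    proof (induction x)
      case 0
      have "rewrites_to R (Copy (Suc k) # num 0 @ frame ys @ w) (Ins # Copy k # frame ys @ w)"
        using rewrites_rule[of "[Copy (Suc k), Zero]" "[Ins, Copy k]" R] Suc.prems(1) by simp
      also have "rewrites_to R \<dots> (Ins # num ?z @ frame ys @ w)"
        using Suc.IH[OF _ k] Suc.prems(1) by (intro rewrites_Cons) simp
      also note rewrites_Ins[OF assms(1)]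
      finally show ?case .
    next
      case (Suc x)
      have "rewrites_to R (Copy (Suc k) # num (Suc x) @ frame ys @ w)
          (Inc2 # Copy (Suc k) # num x @ frame ys @ w)"
        using rewrites_rule[of "[Copy (Suc k), Inc]" "[Inc2, Copy (Suc k)]" R] \<open>copy_rules (Suc k) \<subseteq> R\<close>
        by simp
      also have "rewrites_to R \<dots> (Inc2 # num ?z @ num x @ frame ys @ w)"
        by (intro rewrites_Cons Suc)
      also note rewrites_Inc2[OF assms(1)]
      finally show ?case .
    qed
    then show ?case by (simp add: xs)
  qed
qed

lemma rewrites_replicate_Drop2:
  assumes "stack_rules \<subseteq> R"
  shows "rewrites_to R (replicate (length xs) Drop2 @ num z @ frame xs @ w) (num z @ w)"
proof (induction xs)
  case (Cons x xs)
  have "rewrites_to R (replicate (length xs) Drop2 @ Drop2 # num z @ num x @ frame xs @ w)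
      (replicate (length xs) Drop2 @ num z @ frame xs @ w)"
    by (rule rewrites_right) (rule rewrites_Drop2[OF assms])
  also note Cons
  finally show ?case by (simp add: replicate_app_Cons_same)
qed simp

lemma rewrites_replicate_Copy:
  assumes "stack_rules \<subseteq> R" and "copy_rules K \<subseteq> R" and "k \<le> K" and "length ws = Suc k"
    and "i \<le> Suc k"
  shows "rewrites_to R (replicate i (Copy k) @ frame ws @ w) (frame (drop (Suc k - i) ws @ ws) @ w)"
  using assms(5)
proof (induction i)
  case 0
  then show ?case using assms(4) by simp
next
  case (Suc i)
  let ?d = "drop (Suc k - i) ws"
  have "rewrites_to R (Copy k # replicate i (Copy k) @ frame ws @ w) (Copy k # frame (?d @ ws) @ w)"
    using Suc by (intro rewrites_Cons) simp
  also have "rewrites_to R \<dots> (num ((?d @ ws) ! k) @ frame (?d @ ws) @ w)"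
    by (rule rewrites_Copy[OF assms(1-3)]) (use assms(4) in simp)
  also have "(?d @ ws) ! k = ws ! (k - i)"
    using Suc.prems assms(4) by (simp add: nth_append)
  also have "num (ws ! (k - i)) @ frame (?d @ ws) @ w = frame (drop (Suc k - Suc i) ws @ ws) @ w"
    using Suc.prems assms(4) Cons_nth_drop_Suc[of "k - i" ws, symmetric] by (simp add: Suc_diff_le)
  finally show ?case by simp
qed

lemma rewrites_copy_frame:
  assumes "stack_rules \<subseteq> R" and "copy_rules K \<subseteq> R" and "length ys + length xs \<le> Suc K"
  shows "rewrites_to R (replicate (length xs) (Copy (length ys + length xs - 1)) @ frame ys @ frame xs @ w)
    (frame xs @ frame ys @ frame xs @ w)"
proof (cases "length xs")
  case (Suc k)
  then show ?thesis
    using rewrites_replicate_Copy[OF assms(1,2), of "length ys + k" "ys @ xs" "length xs" w] assms(3)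
    by simp
qed simp

lemma rewrites_args_word:
  assumes "stack_rules \<subseteq> R" and "copy_rules (length gs + length xs) \<subseteq> R"
    and "length ys = length gs"
    and "\<And>i v. i < length gs \<Longrightarrow>
      rewrites_to R (Call (gs ! i) (length xs) # frame xs @ v) (num (ys ! i) @ v)"
  shows "rewrites_to R (args_word (length xs) gs @ frame xs @ w) (frame ys @ frame xs @ w)"
  using assms(2-4)
proof (induction gs arbitrary: ys)
  case (Cons g gs)
  then obtain y zs where ys: "ys = y # zs" "length zs = length gs" by (cases ys) auto
  let ?cp = "Call g (length xs) # replicate (length xs) (Copy (length gs + length xs - 1))"
  have IH: "rewrites_to R (args_word (length xs) gs @ frame xs @ w) (frame zs @ frame xs @ w)"
    using Cons.IH[of zs] Cons.prems(1) Cons.prems(3)[of "Suc _"] ys by auto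
  have "rewrites_to R (?cp @ args_word (length xs) gs @ frame xs @ w) (?cp @ frame zs @ frame xs @ w)"
    using IH by (rule rewrites_right)
  also have "rewrites_to R \<dots> (Call g (length xs) # frame xs @ frame zs @ frame xs @ w)"
    using rewrites_copy_frame[OF assms(1) Cons.prems(1), of zs xs w] ys rewrites_Cons by simp
  also have "rewrites_to R \<dots> (num y @ frame zs @ frame xs @ w)"
    using Cons.prems(3)[of 0] ys by simp
  finally show ?case using ys by simp
qed simp

text \<open>The counter climbs to \<open>n\<close>, so the induction descends from \<open>n\<close>.
  The premises \<open>zero\<close> and \<open>pos\<close> have the form of the induction hypotheses
  available in \<open>rewrites_Call\<close>.\<close>

lemma rewrites_Loop:
  assumes st: "stack_rules \<subseteq> R" and rules: "call_rules (Mn f) (length xs) \<subseteq> R"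
    and zero: "\<And>v. rewrites_to R (Call f (Suc (length xs)) # frame (n # xs) @ v) (num 0 @ v)"
    and pos: "\<And>m. m < n \<Longrightarrow>
      \<exists>y. y \<noteq> 0 \<and> (\<forall>v. rewrites_to R (Call f (Suc (length xs)) # frame (m # xs) @ v) (num y @ v))"
    and "k \<le> n"
  shows "rewrites_to R (Loop f (length xs) # num k @ frame xs @ w) (num n @ w)"
proof -
  let ?m = "length xs"
  have cp: "copy_rules ?m \<subseteq> R" using rules by simp
  have enter: "rewrites_to R (Loop f ?m # num k @ frame xs @ w)
      (Branch f ?m # Call f (Suc ?m) # frame (k # xs) @ frame (k # xs) @ w)" for k
  proof -
    have "rewrites_to R (Loop f ?m # num k @ frame xs @ w)
        ([Branch f ?m, Call f (Suc ?m)] @ replicate (Suc ?m) (Copy ?m) @ frame (k # xs) @ w)"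
      using rewrites_rule[of "[Loop f ?m]"
          "[Branch f ?m, Call f (Suc ?m)] @ replicate (Suc ?m) (Copy ?m)" R "frame (k # xs) @ w"] rules
      by simp
    also have "rewrites_to R \<dots> ([Branch f ?m, Call f (Suc ?m)] @ frame (k # xs) @ frame (k # xs) @ w)"
      using rewrites_copy_frame[OF st cp, of "[]" "k # xs" w] by (intro rewrites_right) simp
    finally show ?thesis by simp
  qed
  show ?thesis using \<open>k \<le> n\<close>
  proof (induction rule: inc_induct)
    case base
    note enter[of n]
    also have "rewrites_to R (Branch f ?m # Call f (Suc ?m) # frame (n # xs) @ frame (n # xs) @ w)
        (Branch f ?m # num 0 @ frame (n # xs) @ w)"
      by (intro rewrites_Cons zero)
    also have "rewrites_to R \<dots> (replicate ?m Drop2 @ Drop2 # Swap # num 0 @ num n @ frame xs @ w)"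
      using rewrites_rule[of "[Branch f ?m, Zero]" "replicate ?m Drop2 @ [Drop2, Swap, Zero]" R] rules
      by simp
    also have "rewrites_to R \<dots> (replicate ?m Drop2 @ Drop2 # num n @ num 0 @ frame xs @ w)"
      by (intro rewrites_right rewrites_Cons rewrites_Swap st)
    also have "rewrites_to R \<dots> (replicate ?m Drop2 @ num n @ frame xs @ w)"
      by (intro rewrites_right rewrites_Drop2 st)
    also note rewrites_replicate_Drop2[OF st]
    finally show ?case .
  next
    case (step k)
    from pos[OF step.hyps(2)] obtain y where
      y: "\<And>v. rewrites_to R (Call f (Suc ?m) # frame (k # xs) @ v) (num (Suc y) @ v)"
      by (metis not0_implies_Suc)
    note enter[of k]
    also have "rewrites_to R (Branch f ?m # Call f (Suc ?m) # frame (k # xs) @ frame (k # xs) @ w)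
        (Branch f ?m # num (Suc y) @ frame (k # xs) @ w)"
      by (intro rewrites_Cons y)
    also have "rewrites_to R \<dots> (Loop f ?m # Inc # Drop2 # Swap # num y @ num k @ frame xs @ w)"
      using rewrites_rule[of "[Branch f ?m, Inc]" "[Loop f ?m, Inc, Drop2, Swap]" R] rules by simp
    also have "rewrites_to R \<dots> (Loop f ?m # Inc # Drop2 # num k @ num y @ frame xs @ w)"
      by (intro rewrites_Cons rewrites_Swap st)
    also have "rewrites_to R \<dots> (Loop f ?m # Inc # num k @ frame xs @ w)"
      by (intro rewrites_Cons rewrites_Drop2 st)
    also have "rewrites_to R \<dots> (num n @ w)" using step.IH by simp
    finally show ?case .
  qed
qed

lemma rewrites_Call:
  assumes "stack_rules \<subseteq> R" and "reval f xs z" and "call_rules f (length xs) \<subseteq> R"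
  shows "rewrites_to R (Call f (length xs) # frame xs @ w) (num z @ w)"
  using assms(2,3)
proof (induction arbitrary: w rule: reval.induct)
  case (reval_Z xs)
  have "rewrites_to R (Call Z (length xs) # frame xs @ w)
      (replicate (length xs) Drop2 @ num 0 @ frame xs @ w)"
    using rewrites_rule[of "[Call Z (length xs)]" "replicate (length xs) Drop2 @ [Zero]" R] reval_Z by simp
  also note rewrites_replicate_Drop2[OF assms(1)]
  finally show ?case .
next
  case (reval_S x xs)
  have "rewrites_to R (Call S (length (x # xs)) # frame (x # xs) @ w)
      (Inc # replicate (length xs) Drop2 @ num x @ frame xs @ w)"
    using rewrites_rule[of "[Call S (length (x # xs))]" "Inc # replicate (length xs) Drop2" R] reval_S
    by simp
  also have "rewrites_to R \<dots> (Inc # num x @ w)"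
    by (intro rewrites_Cons rewrites_replicate_Drop2 assms(1))
  finally show ?case by simp
next
  case (reval_Id i xs)
  have cp: "copy_rules i \<subseteq> R" using reval_Id by simp
  have "rewrites_to R (Call (Id i) (length xs) # frame xs @ w)
      (replicate (length xs) Drop2 @ Copy i # frame xs @ w)"
    using rewrites_rule[of "[Call (Id i) (length xs)]" "replicate (length xs) Drop2 @ [Copy i]" R] reval_Id
    by simp
  also have "rewrites_to R \<dots> (replicate (length xs) Drop2 @ num (xs ! i) @ frame xs @ w)"
    using reval_Id by (intro rewrites_right rewrites_Copy[OF assms(1) cp]) auto
  also note rewrites_replicate_Drop2[OF assms(1)]
  finally show ?case .
next
  case (reval_Cn ys gs xs f z)
  have "rewrites_to R (Call (Cn f gs) (length xs) # frame xs @ w)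
      (replicate (length xs) Drop2 @ Call f (length gs) # args_word (length xs) gs @ frame xs @ w)"
    using rewrites_rule[of "[Call (Cn f gs) (length xs)]"
        "replicate (length xs) Drop2 @ Call f (length gs) # args_word (length xs) gs" R] reval_Cn.prems
    by simp
  also have "rewrites_to R \<dots>
      (replicate (length xs) Drop2 @ Call f (length gs) # frame ys @ frame xs @ w)"
  proof (intro rewrites_right rewrites_Cons rewrites_args_word assms(1))
    show "copy_rules (length gs + length xs) \<subseteq> R" using reval_Cn.prems by simp
    show "length ys = length gs" by fact
    fix i v assume "i < length gs"
    then show "rewrites_to R (Call (gs ! i) (length xs) # frame xs @ v) (num (ys ! i) @ v)"
      using reval_Cn.IH(1) reval_Cn.prems by (auto simp: UN_subset_iff)
  qed
  also have "rewrites_to R \<dots> (replicate (length xs) Drop2 @ num z @ frame xs @ w)"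
    using reval_Cn.IH(2)[of "frame xs @ w"] reval_Cn.prems reval_Cn.hyps(1)
    by (intro rewrites_right) simp
  also note rewrites_replicate_Drop2[OF assms(1)]
  finally show ?case .
next
  case (reval_Pr0 f xs z g)
  have "rewrites_to R (Call (Pr f g) (length (0 # xs)) # frame (0 # xs) @ w) (Call f (length xs) # frame xs @ w)"
    using rewrites_rule[of "[Call (Pr f g) (length (0 # xs)), Zero]" "[Call f (length xs)]" R] reval_Pr0.prems
    by simp
  also have "rewrites_to R \<dots> (num z @ w)"
    using reval_Pr0.prems by (intro reval_Pr0.IH) simp
  finally show ?case .
next
  case (reval_PrS f g n xs y z)
  let ?m = "Suc (length xs)"
  have cp: "copy_rules (length xs) \<subseteq> R" using reval_PrS.prems by simp
  have "rewrites_to R (Call (Pr f g) ?m # frame (Suc n # xs) @ w)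
      ([Call g (Suc ?m), Swap, Call (Pr f g) ?m] @ replicate ?m (Copy (length xs)) @ frame (n # xs) @ w)"
    using rewrites_rule[of "[Call (Pr f g) ?m, Inc]"
       "[Call g (Suc ?m), Swap, Call (Pr f g) ?m] @ replicate ?m (Copy (length xs))" R] reval_PrS.prems
    by simp
  also have "rewrites_to R \<dots>
      ([Call g (Suc ?m), Swap, Call (Pr f g) ?m] @ frame (n # xs) @ frame (n # xs) @ w)"
    using rewrites_copy_frame[OF assms(1) cp, of "[]" "n # xs" w] by (intro rewrites_right) simp
  also have "rewrites_to R \<dots> ([Call g (Suc ?m), Swap] @ num y @ num n @ frame xs @ w)"
    using reval_PrS.IH(1)[of "frame (n # xs) @ w"] reval_PrS.prems by (simp add: rewrites_Cons)
  also have "rewrites_to R \<dots> ([Call g (Suc ?m)] @ num n @ num y @ frame xs @ w)"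
    using rewrites_Swap[OF assms(1)] by (simp add: rewrites_Cons)
  also have "rewrites_to R \<dots> (num z @ w)"
    using reval_PrS.IH(2)[of w] reval_PrS.prems by simp
  finally show ?case by simp
next
  case (reval_Mn f n xs)
  have rules: "call_rules f (Suc (length xs)) \<subseteq> R" using reval_Mn.prems by simp
  have "rewrites_to R (Call (Mn f) (length xs) # frame xs @ w) (Loop f (length xs) # num 0 @ frame xs @ w)"
    using rewrites_rule[of "[Call (Mn f) (length xs)]" "[Loop f (length xs), Zero]" R] reval_Mn.prems
    by simp
  also have "rewrites_to R \<dots> (num n @ w)"
    using reval_Mn.IH rules by (intro rewrites_Loop[OF assms(1) reval_Mn.prems]) (auto; metis)+
  finally show ?case .
qed

lemma program_complete:
  assumes "reval F xs 1"
  shows "rewrites_to (program_rules F (length xs)) (Start # frame xs) [Yes]"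
proof -
  let ?R = "program_rules F (length xs)"
  have "rewrites_to ?R (Start # frame xs) (Test # Call F (length xs) # frame xs)"
    using rewrites_rule[of "[Start]" "[Test, Call F (length xs)]" ?R] by (simp add: program_rules_def)
  also have "rewrites_to ?R \<dots> (Test # num 1)"
    using rewrites_Call[OF _ assms, of ?R "[]"] by (intro rewrites_Cons) (auto simp: program_rules_def)
  also have "rewrites_to ?R \<dots> [Yes]"
    using rewrites_rule[of "[Test, Inc, Zero]" "[Yes]" ?R "[]"]
    by (simp add: program_rules_def stack_rules_def)
  finally show ?thesis .
qed

section \<open>Post correspondence\<close>

abbreviation tops :: "('a list \<times> 'a list) list \<Rightarrow> 'a list" where
  "tops ds \<equiv> concat (map fst ds)"

abbreviation bots :: "('a list \<times> 'a list) list \<Rightarrow> 'a list" where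
  "bots ds \<equiv> concat (map snd ds)"

text \<open>A word without the separator cannot reach back across it, so it is a suffix of the part
  after \<open>h\<close>.\<close>

lemma append_eq_append_sep:
  assumes "x @ r = y @ h # s" and "h \<notin> set r"
  shows "\<exists>s'. s = s' @ r \<and> x = y @ h # s'"
  using assms by (auto simp: append_eq_append_conv2 append_eq_Cons_conv)

text \<open>Read from the right, the bottoms run ahead of the tops by \<open>t @ h # s\<close>, where \<open>s\<close> is the unread part
  of the current configuration and \<open>t\<close> the part of the preceding one already produced. Rules enter
  backwards (top \<open>r\<close>, bottom \<open>l\<close>), so the run starts at \<open>y\<close> and ends at the start word \<open>u\<close>. The residue
  \<open>w\<close> does no harm, since the semantics of \<open>u\<close> does not depend on what is executed before it.\<close>

lemma correspondence_sound:
  assumes "set ds \<subseteq> {(h # u, [])} \<union> {([a], [a]) | a. True} \<union> R\<inverse>"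
    and u: "h \<notin> set u" and R: "\<And>l r. (l, r) \<in> R \<Longrightarrow> h \<notin> set l \<and> h \<notin> set r"
    and "tops ds = bots ds @ t @ h # s" and "h \<notin> set s" and "h \<notin> set t"
    and "rewrites_to R (s @ t) y"
  shows "\<exists>w. rewrites_to R (u @ w) y"
  using assms(1,4-)
proof (induction ds arbitrary: s t rule: rev_induct)
  case (snoc d ds)
  from snoc.prems(1) consider "d = (h # u, [])" | a where "d = ([a], [a])"
    | l r where "d = (r, l)" "(l, r) \<in> R"
    by auto
  then show ?case
  proof cases
    case 1
    with snoc.prems have eq: "(tops ds @ [h]) @ u = (bots ds @ t) @ h # s" by simp
    from append_eq_append_sep[OF eq u] obtain s' where s': "s = s' @ u"
      "tops ds @ [h] = (bots ds @ t) @ h # s'" by blast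
    \<comment> \<open>A nonempty \<open>s'\<close> would end in \<open>h\<close>, which
      \<open>s\<close> does not contain.\<close>
    have "s' = []" using s' snoc.prems(3) by (cases s' rule: rev_cases) auto
    with s' snoc.prems show ?thesis by auto
  next
    case 2
    show ?thesis
    proof (cases s rule: rev_cases)
      case Nil
      \<comment> \<open>With \<open>s\<close> used up, the copied letter is the separator. The
        collected word \<open>t\<close> becomes the unread configuration, and collecting starts
        afresh.\<close>
      with snoc.prems 2 have "tops ds = bots ds @ [] @ h # t" and "a = h" by auto
      with snoc.IH[of "[]" t] snoc.prems Nil show ?thesis by simp
    next
      case (snoc s' b)
      with snoc.prems 2 have "tops ds = bots ds @ (a # t) @ h # s'" "b = a" by auto
      with snoc.IH[of "a # t" s'] snoc.prems snoc show ?thesis by simp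
    qed
  next
    case 3
    with snoc.prems have eq: "tops ds @ r = (bots ds @ l @ t) @ h # s" by simp
    from append_eq_append_sep[OF eq] R[OF 3(2)] obtain s' where s': "s = s' @ r"
      "tops ds = (bots ds @ l @ t) @ h # s'" by blast
    have "rewrite_step R (s' @ l @ t) (s' @ r @ t)"
      using 3(2) by (rule rewrite_step.intros)
    then have "rewrites_to R (s' @ l @ t) y"
      using snoc.prems(5) s'(1) by (simp add: converse_rtranclp_into_rtranclp)
    with snoc.IH[of "l @ t" s'] s' snoc.prems R[OF 3(2)] show ?thesis by simp
  qed
qed auto

text \<open>The domino sequence is built from left to right, with one pass over the current
  configuration for each rewrite step.\<close>

lemma correspondence_complete:
  assumes D: "{(h # u, [])} \<union> (\<lambda>a. ([a], [a])) ` A \<union> R\<inverse> \<subseteq> D" and "h \<in> A"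
    and u: "set u \<subseteq> A" and R: "\<And>l r. (l, r) \<in> R \<Longrightarrow> set l \<subseteq> A \<and> set r \<subseteq> A"
    and "rewrites_to R u y"
  shows "\<exists>ds. set ds \<subseteq> D \<and> tops ds = bots ds @ h # y"
proof -
  \<comment> \<open>The tops lead by \<open>t\<close>, the rest of the current configuration still
    to be matched, and by \<open>s\<close>, the part of the next one written so far.\<close>
  define sol where "sol t s \<longleftrightarrow> (\<exists>ds. set ds \<subseteq> D \<and> tops ds = bots ds @ t @ h # s)" for t s
  have extend: "sol t' s'" if "sol t s" "(p, q) \<in> D" "\<And>x. (x @ t @ h # s) @ p = x @ q @ t' @ h # s'" for t s p q t' s'
  proof -
    from that(1) obtain ds where "set ds \<subseteq> D" "tops ds = bots ds @ t @ h # s"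
      unfolding sol_def by blast
    with that(2,3) have "set (ds @ [(p, q)]) \<subseteq> D" "tops (ds @ [(p, q)]) = bots (ds @ [(p, q)]) @ t' @ h # s'"
      by simp_all
    then show ?thesis unfolding sol_def by blast
  qed
  have rotate: "sol t (s @ v)" if "sol (v @ t) s" "set v \<subseteq> A" for v t s
    using that
  proof (induction v arbitrary: s)
    case (Cons a v)
    have "sol (v @ t) (s @ [a])"
      by (rule extend[OF Cons.prems(1), of "[a]" "[a]"]) (use D Cons.prems(2) in auto)
    then show ?case using Cons.IH[of "s @ [a]"] Cons.prems(2) by simp
  qed simp
  have wrap: "sol t []" if "sol [] t" for t
    by (rule extend[OF that, of "[h]" "[h]"]) (use D \<open>h \<in> A\<close> in auto)
  have "sol [] y \<and> set y \<subseteq> A"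
    using assms(5)
  proof (induction rule: rtranclp_induct)
    case base
    have "set [(h # u, [])] \<subseteq> D" using D by simp
    moreover have "tops [(h # u, [])] = bots [(h # u, [])] @ [] @ h # u" by simp
    ultimately show ?case unfolding sol_def using u by blast
  next
    case (step x z)
    from step.hyps(2) show ?case
    proof cases
      case (1 l r a b)
      have ab: "set a \<subseteq> A" "set b \<subseteq> A" using step.IH 1(1) by auto
      \<comment> \<open>One pass: a separator makes \<open>a @ l @ b\<close> the word to be matched,
        \<open>a\<close> is copied, the rule domino exchanges \<open>l\<close> for \<open>r\<close>,
        and \<open>b\<close> is copied.\<close>
      have "sol (a @ l @ b) []" using wrap step.IH 1(1) by simp
      then have "sol (l @ b) a" using rotate[of a "l @ b" "[]"] ab by simp
      then have "sol b (a @ r)"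
        by (rule extend[of _ _ r l]) (use D 1(3) in auto)
      then have "sol [] (a @ r @ b)" using rotate[of b "[]" "a @ r"] ab by simp
      with 1 ab R[OF 1(3)] show ?thesis by simp
    qed
  qed
  then show ?thesis unfolding sol_def by simp
qed

section \<open>The dominoes of a program\<close>

lemma args_word_no_Hash: "Hash \<notin> set (args_word m gs)"
  by (induction gs) auto

lemma copy_rules_no_Hash: "(l, r) \<in> copy_rules k \<Longrightarrow> Hash \<notin> set l \<and> Hash \<notin> set r"
  by (induction k) auto

lemma call_rules_no_Hash: "(l, r) \<in> call_rules f m \<Longrightarrow> Hash \<notin> set l \<and> Hash \<notin> set r"
proof (induction f m rule: call_rules.induct)
  case (3 i m)
  then show ?case by (auto dest: copy_rules_no_Hash split: if_splits)
next
  case (5 f g m)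
  then show ?case by (cases m) (auto dest: copy_rules_no_Hash)
qed (auto dest: copy_rules_no_Hash simp: args_word_no_Hash split: if_splits)

lemma program_rules_no_Hash:
  "(l, r) \<in> program_rules F n \<Longrightarrow> Hash \<notin> set l \<and> Hash \<notin> set r"
  unfolding program_rules_def stack_rules_def by (auto dest: call_rules_no_Hash)

lemma frame_no_Hash: "Hash \<notin> set (frame xs)"
  by (auto simp: frame_def num_def)

text \<open>\<open>rest\<close> is fixed before \<open>xs\<close>, and only the start domino
  mentions \<open>xs\<close>. This allows the diagonal argument to run the program on numbers that
  describe \<open>rest\<close>.\<close>

lemma program_correspondence:
  "\<exists>rest. \<forall>xs. length xs = n \<longrightarrow>
     (reval F xs 1 \<longleftrightarrow>
      (\<exists>ds. set ds \<subseteq> set ((Hash # Start # frame xs, []) # rest) \<and> tops ds = bots ds @ [Hash, Yes]))"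
proof -
  let ?R = "program_rules F n"
  \<comment> \<open>The letters that configurations can contain; being finitely many, they require
    finitely many copy dominoes.\<close>
  define A where "A = {Hash, Yes, Start, Zero, Inc} \<union> (\<Union>(l, r)\<in>?R. set l \<union> set r)"
  have "finite A" unfolding A_def by (simp add: case_prod_unfold finite_program_rules)
  then have "finite ((\<lambda>a. ([a], [a])) ` A \<union> ?R\<inverse>)" by (simp add: finite_program_rules)
  from finite_list[OF this] obtain rest where rest: "set rest = (\<lambda>a. ([a], [a])) ` A \<union> ?R\<inverse>" ..
  have "reval F xs 1 \<longleftrightarrow>
      (\<exists>ds. set ds \<subseteq> set ((Hash # Start # frame xs, []) # rest) \<and> tops ds = bots ds @ [Hash, Yes])"
    (is "_ \<longleftrightarrow> ?S") if n: "length xs = n" for xs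
  proof
    assume "reval F xs 1"
    from program_complete[OF this] n have rw: "rewrites_to ?R (Start # frame xs) [Yes]" by simp
    show ?S
    proof (rule correspondence_complete[OF _ _ _ _ rw])
      show "{(Hash # Start # frame xs, [])} \<union> (\<lambda>a. ([a], [a])) ` A \<union> ?R\<inverse>
          \<subseteq> set ((Hash # Start # frame xs, []) # rest)"
        unfolding list.set rest by blast
      show "Hash \<in> A" by (simp add: A_def)
      show "set (Start # frame xs) \<subseteq> A" by (auto simp: A_def frame_def num_def)
      show "set l \<subseteq> A \<and> set r \<subseteq> A" if "(l, r) \<in> ?R" for l r
        using that unfolding A_def by blast
    qed
  next
    assume ?S
    then obtain ds where ds: "set ds \<subseteq> set ((Hash # Start # frame xs, []) # rest)"
      "tops ds = bots ds @ [] @ Hash # [Yes]" unfolding append_Nil by blast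
    \<comment> \<open>Here \<open>t\<close> is empty, and \<open>s\<close> and \<open>y\<close> are
      both \<open>[Yes]\<close>, so the induction starts from the empty derivation.\<close>
    have "\<exists>w. rewrites_to ?R ((Start # frame xs) @ w) [Yes]"
    proof (rule correspondence_sound[OF _ _ _ ds(2)])
      show "set ds \<subseteq> {(Hash # Start # frame xs, [])} \<union> {([a], [a]) | a. True} \<union> ?R\<inverse>"
        using ds(1) unfolding list.set rest by blast
      show "Hash \<notin> set (Start # frame xs)" using frame_no_Hash by simp
      show "Hash \<notin> set l \<and> Hash \<notin> set r" if "(l, r) \<in> ?R" for l r
        using program_rules_no_Hash that by blast
    qed simp_all
    then obtain w where "rewrites_to (program_rules F (length xs)) (Start # frame xs @ w) [Yes]"
      unfolding n append_Cons by blast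
    then show "reval F xs 1" by (rule program_sound)
  qed
  then show ?thesis by blast
qed

instance recf :: countable by countable_datatype
instance sym :: countable by countable_datatype

text \<open>The symbols of start words need codes known in advance, because the start word is computed
  by the very function whose call symbols are being encoded.\<close>

definition code :: "sym \<Rightarrow> nat" where
  "code a = (if a = Hash then 0 else if a = Zero then 1 else if a = Inc then 2
     else if a = Yes then 3 else if a = Start then 4 else 5 + to_nat a)"

lemma inj_code: "inj code"
  by (rule injI) (auto simp: code_def split: if_splits)

section \<open>Domino transducers\<close>

definition mat6 :: "(nat \<Rightarrow> nat \<Rightarrow> alg_desc) \<Rightarrow> alg_desc list list" where
  "mat6 f = map (\<lambda>q. map (f q) [0..<6]) [0..<6]"

lemma mat6_nth: "q < 6 \<Longrightarrow> p < 6 \<Longrightarrow> mat6 f ! q ! p = f q p"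
  by (simp add: mat6_def)

lemma sum_less_6: "(\<Sum>p<6. f p) = f 0 + f (Suc 0) + f 2 + f 3 + f 4 + f (5::nat)"
  by (simp add: eval_nat_numeral)

lemma all_less_6: "(\<forall>p<6. P p) \<longleftrightarrow> P 0 \<and> P (Suc 0) \<and> P 2 \<and> P 3 \<and> P 4 \<and> P (5::nat)"
  by (simp add: eval_nat_numeral All_less_Suc conj_ac)

section \<open>Algebraic descriptions of the matrix entries\<close>

definition alg_zero :: alg_desc where "alg_zero = ([0, 1], 0, 0, 0, 0)"
definition alg_one :: alg_desc where "alg_one = ([- 1, 1], 1, 1, 0, 0)"
definition alg_third :: alg_desc where "alg_third = ([- 1, 3], 1 / 3, 1 / 3, 0, 0)"
text \<open>The two descriptions of square roots share the polynomial \<open>3 X^2 - 1\<close>; the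
  sign of the real part, enforced by the box, selects the root.\<close>

definition alg_root :: alg_desc where "alg_root = ([- 1, 0, 3], 0, 1, 0, 0)"
definition alg_neg_root :: alg_desc where "alg_neg_root = ([- 1, 0, 3], - 1, 0, 0, 0)"

lemma alg_descI:
  assumes "\<exists>c\<in>set (fst e). c \<noteq> 0" and "\<And>z. poly_of_coeffs (fst e) z = 0 \<and> in_box e z \<longleftrightarrow> z = x"
  shows "valid_alg e \<and> alg_val e = x"
  using assms by (simp add: valid_alg_def alg_val_def)

lemma alg_zero: "valid_alg alg_zero \<and> alg_val alg_zero = 0"
  by (rule alg_descI) (auto simp: alg_zero_def poly_of_coeffs_def in_box_def)

lemma alg_one: "valid_alg alg_one \<and> alg_val alg_one = 1"
  by (rule alg_descI) (auto simp: alg_one_def poly_of_coeffs_def in_box_def)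

lemma alg_third: "valid_alg alg_third \<and> alg_val alg_third = of_real (1 / 3)"
  by (rule alg_descI) (auto simp: alg_third_def poly_of_coeffs_def in_box_def complex_eq_iff of_rat_divide)

lemma root_three_iff:
  "- 1 + 3 * z\<^sup>2 = 0 \<and> Im z = 0 \<longleftrightarrow> z = of_real (1 / sqrt 3) \<or> z = of_real (- (1 / sqrt 3))"
  for z :: complex
proof -
  have real: "- 1 + 3 * x\<^sup>2 = 0 \<longleftrightarrow> x = 1 / sqrt 3 \<or> x = - (1 / sqrt 3)" for x :: real
  proof -
    have "- 1 + 3 * x\<^sup>2 = 0 \<longleftrightarrow> x\<^sup>2 = (1 / sqrt 3)\<^sup>2" by (simp add: power_divide) linarith
    then show ?thesis by (simp only: power2_eq_iff)
  qed
  have cplx: "- 1 + 3 * (of_real x)\<^sup>2 = (0::complex) \<longleftrightarrow> - 1 + 3 * x\<^sup>2 = 0" for x :: real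
    using of_real_eq_0_iff[of "- 1 + 3 * x\<^sup>2", where 'a = complex] by simp
  show ?thesis
  proof
    assume z: "- 1 + 3 * z\<^sup>2 = 0 \<and> Im z = 0"
    then have "z = of_real (Re z)" by (simp add: complex_eq_iff)
    with z show "z = of_real (1 / sqrt 3) \<or> z = of_real (- (1 / sqrt 3))"
      using cplx[of "Re z"] real[of "Re z"] by metis
  next
    assume "z = of_real (1 / sqrt 3) \<or> z = of_real (- (1 / sqrt 3))"
    then show "- 1 + 3 * z\<^sup>2 = 0 \<and> Im z = 0"
      using cplx real by (metis Im_complex_of_real)
  qed
qed

lemma alg_root: "valid_alg alg_root \<and> alg_val alg_root = of_real (1 / sqrt 3)"
proof (rule alg_descI)
  fix z
  have "poly_of_coeffs (fst alg_root) z = 0 \<and> in_box alg_root z \<longleftrightarrow>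
      (- 1 + 3 * z\<^sup>2 = 0 \<and> Im z = 0) \<and> 0 \<le> Re z \<and> Re z \<le> 1"
    by (auto simp: alg_root_def poly_of_coeffs_def in_box_def eval_nat_numeral)
  also have "\<dots> \<longleftrightarrow> z = of_real (1 / sqrt 3)"
    unfolding root_three_iff by auto
  finally show "poly_of_coeffs (fst alg_root) z = 0 \<and> in_box alg_root z \<longleftrightarrow> z = of_real (1 / sqrt 3)" .
qed (simp add: alg_root_def)

lemma alg_neg_root: "valid_alg alg_neg_root \<and> alg_val alg_neg_root = - of_real (1 / sqrt 3)"
proof (rule alg_descI)
  fix z
  have "poly_of_coeffs (fst alg_neg_root) z = 0 \<and> in_box alg_neg_root z \<longleftrightarrow>
      (- 1 + 3 * z\<^sup>2 = 0 \<and> Im z = 0) \<and> - 1 \<le> Re z \<and> Re z \<le> 0"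
    by (auto simp: alg_neg_root_def poly_of_coeffs_def in_box_def eval_nat_numeral)
  also have "\<dots> \<longleftrightarrow> z = - of_real (1 / sqrt 3)"
    unfolding root_three_iff by auto
  finally show "poly_of_coeffs (fst alg_neg_root) z = 0 \<and> in_box alg_neg_root z \<longleftrightarrow> z = - of_real (1 / sqrt 3)" .
qed (simp add: alg_neg_root_def)

definition delta :: "nat \<Rightarrow> nat \<Rightarrow> alg_desc" where
  "delta q p = (if q = p then alg_one else alg_zero)"

lemma delta: "valid_alg (delta q p) \<and> alg_val (delta q p) = (if q = p then 1 else 0)"
  by (simp add: delta_def alg_zero alg_one)

text \<open>States 0 and 1 emit the tops and the bottoms of the dominoes, state 2 is initial,
  states 3 and 4 are accepting (one for each branch), state 5 is rejecting.\<close>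

definition transducer :: "(nat \<Rightarrow> nat \<Rightarrow> alg_desc) \<Rightarrow> (nat \<Rightarrow> nat \<Rightarrow> alg_desc) \<Rightarrow> nat
    \<Rightarrow> (nat list \<times> nat list) list \<Rightarrow> nat list \<Rightarrow> fst_desc" where
  "transducer L R K doms e = FST 6 (length doms) K 2 [3, 4] [5]
     (replicate (length doms) (mat6 delta) @ [mat6 L, mat6 R])
     (map (\<lambda>d. [fst d, snd d, [], [], [], []]) doms @ [replicate 6 [], [[], e, [], [], [], []]])"

lemma transducer_sel [simp]:
  "nstates (transducer L R K doms e) = 6"
  "ninput (transducer L R K doms e) = length doms"
  "noutput (transducer L R K doms e) = K"
  "init (transducer L R K doms e) = 2"
  "accs (transducer L R K doms e) = [3, 4]"
  "rejs (transducer L R K doms e) = [5]"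
  by (simp_all add: transducer_def)

lemma halting_transducer: "halting (transducer L R K doms e) p \<longleftrightarrow> p \<in> {3, 4, 5}"
  by (auto simp: halting_def)

lemma outf_transducer:
  "i < length doms \<Longrightarrow> outf (transducer L R K doms e) i q = [fst (doms ! i), snd (doms ! i), [], [], [], []] ! q"
  "q < 6 \<Longrightarrow> outf (transducer L R K doms e) (length doms) q = []"
  "outf (transducer L R K doms e) (Suc (length doms)) q = [[], e, [], [], [], []] ! q"
  by (simp_all add: outf_def transducer_def nth_append)

lemma Vc_transducer:
  assumes "q < 6" and "p < 6"
  shows "i < length doms \<Longrightarrow> Vc (transducer L R K doms e) i q p = (if q = p then 1 else 0)"
    and "Vc (transducer L R K doms e) (length doms) q p = alg_val (L q p)"
    and "Vc (transducer L R K doms e) (Suc (length doms)) q p = alg_val (R q p)"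
  using assms by (simp_all add: Vc_def transducer_def nth_append mat6_nth delta)

lemma valid_common_transducer:
  assumes "\<And>q p. q < 6 \<Longrightarrow> p < 6 \<Longrightarrow> valid_alg (L q p) \<and> valid_alg (R q p)"
    and "\<And>d. d \<in> set doms \<Longrightarrow> set (fst d) \<subseteq> {..<K} \<and> set (snd d) \<subseteq> {..<K}"
    and "set e \<subseteq> {..<K}"
  shows "valid_common (transducer L R K doms e)"
proof -
  have mat: "length (mat6 f) = 6 \<and> (\<forall>r\<in>set (mat6 f). length r = 6 \<and> (\<forall>e\<in>set r. valid_alg e))"
    if "\<And>q p. q < 6 \<Longrightarrow> p < 6 \<Longrightarrow> valid_alg (f q p)" for f
    using that by (auto simp: mat6_def)
  have "\<forall>A\<in>set (trans (transducer L R K doms e)). length A = 6 \<and>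
      (\<forall>r\<in>set A. length r = 6 \<and> (\<forall>e\<in>set r. valid_alg e))"
    using mat[of L] mat[of R] mat[of delta] assms(1) delta
    by (auto simp: transducer_def split: if_splits)
  moreover have "\<forall>A\<in>set (outs (transducer L R K doms e)). length A = 6 \<and>
      (\<forall>ol\<in>set A. \<forall>c\<in>set ol. c < K)"
    using assms(2,3) by (fastforce simp: transducer_def)
  ultimately show ?thesis
    unfolding valid_common_def by (simp add: transducer_def)
qed

text \<open>This evaluates one summand of \<open>step\<close> for a state whose weight sits on the
  single word \<open>w\<close>.\<close>

lemma suffix_weight:
  "(if length u \<le> length x \<and> drop (length x - length u) x = u
    then (if take (length x - length u) x = w then c else 0) * d else 0) =
   (if x = w @ u then c * d else (0::'a::comm_ring_1))"
proof (cases "x = w @ u")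
  case False
  then have "\<not> (drop (length x - length u) x = u \<and> take (length x - length u) x = w)"
    by (metis append_take_drop_id)
  with False show ?thesis by auto
qed simp

definition branches :: "'a::comm_ring_1 \<Rightarrow> nat list \<Rightarrow> nat list \<Rightarrow> nat \<Rightarrow> nat list \<Rightarrow> 'a" where
  "branches c a b q x = (if q = 0 \<and> x = a \<or> q = Suc 0 \<and> x = b then c else 0)"

lemma step_branches:
  assumes "nstates D = 6" and "\<And>q x. q < 6 \<Longrightarrow> \<mu> q x = branches c a b q x"
  shows "step D V i \<mu> p x = (if x = a @ outf D i 0 then c * V i 0 p else 0)
    + (if x = b @ outf D i (Suc 0) then c * V i (Suc 0) p else 0)"
proof -
  have "\<mu> 0 = (\<lambda>x. if x = a then c else 0)" "\<mu> (Suc 0) = (\<lambda>x. if x = b then c else 0)"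
    "\<mu> 2 = (\<lambda>x. 0)" "\<mu> 3 = (\<lambda>x. 0)" "\<mu> 4 = (\<lambda>x. 0)" "\<mu> 5 = (\<lambda>x. 0)"
    using assms(2) by (auto simp: branches_def fun_eq_iff)
  then show ?thesis
    unfolding step_def assms(1) sum_less_6 by (simp only: suffix_weight) simp
qed

text \<open>Weights in an arbitrary commutative ring let a single induction serve probabilities and
  amplitudes. After the left end marker only the two branches survive, since whatever moves from
  state 2 to the rejecting state 5 halts at once.\<close>

lemma transducer_step:
  fixes V :: "nat \<Rightarrow> nat \<Rightarrow> nat \<Rightarrow> 'a::comm_ring_1" and L R K doms e v c
  defines "D \<equiv> transducer L R K doms e"
  defines "N \<equiv> length doms"
  defines "s \<equiv> tape D v"
  defines "ds \<equiv> map ((!) doms) v"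
  assumes V: "\<And>i q p. i < N \<Longrightarrow> q < 6 \<Longrightarrow> p < 6 \<Longrightarrow> V i q p = (if q = p then 1 else 0)"
    and VL: "V N 2 0 = c" "V N 2 (Suc 0) = c" "V N 2 2 = 0" "V N 2 3 = 0" "V N 2 4 = 0"
    and VR: "V (Suc N) 0 3 = 1" "V (Suc N) 0 4 = 0" "V (Suc N) (Suc 0) 3 = 0" "V (Suc N) (Suc 0) 4 = 1"
    and v: "v \<in> lists {..<N}"
  shows "k \<le> length v \<Longrightarrow> p \<in> {3, 4} \<Longrightarrow> step D V (s ! k) (run D V s k) p w = 0"
    and "step D V (s ! Suc (length v)) (run D V s (Suc (length v))) 3 w =
      (if w = tops ds then c else 0)"
    and "step D V (s ! Suc (length v)) (run D V s (Suc (length v))) 4 w =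
      (if w = bots ds @ e then c else 0)"
proof -
  have s0: "s ! 0 = N" and sS: "\<And>k. k < length v \<Longrightarrow> s ! Suc k = v ! k"
    and sl: "s ! Suc (length v) = Suc N"
    by (simp_all add: s_def tape_def D_def N_def nth_append)
  have vN: "k < length v \<Longrightarrow> v ! k < N" for k using v by (auto simp: in_lists_conv_set)
  have first: "step D V (s ! 0) (run D V s 0) p x = (if x = [] then V N 2 p else 0)" for p x
    unfolding s0 step_def
    by (simp add: D_def N_def sum_less_6 outf_transducer)
  have out: "outf D (v ! k) 0 = fst (ds ! k)" "outf D (v ! k) (Suc 0) = snd (ds ! k)" if "k < length v" for k
    using vN[OF that] that by (simp_all add: D_def N_def outf_transducer ds_def)
  have run: "run D V s (Suc k) q x = branches c (tops (take k ds)) (bots (take k ds)) q x"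
    if "k \<le> length v" "q < 6" for k q x
    using that
  proof (induction k arbitrary: q x)
    case 0
    have "\<not> halting D q \<longleftrightarrow> q = 0 \<or> q = Suc 0 \<or> q = 2"
      using 0 by (auto simp: D_def halting_transducer)
    then show ?case using VL first by (auto simp: branches_def simp del: run.simps(1))
  next
    case (Suc k)
    then have k: "k < length v" by simp
    have "\<not> halting D q \<longleftrightarrow> q = 0 \<or> q = Suc 0 \<or> q = 2"
      using Suc.prems by (auto simp: D_def halting_transducer)
    moreover have "take (Suc k) ds = take k ds @ [ds ! k]"
      using k by (simp add: take_Suc_conv_app_nth ds_def)
    moreover have "step D V (s ! Suc k) (run D V s (Suc k)) q x =
        (if x = tops (take k ds) @ outf D (s ! Suc k) 0 then c * V (s ! Suc k) 0 q else 0)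
        + (if x = bots (take k ds) @ outf D (s ! Suc k) (Suc 0) then c * V (s ! Suc k) (Suc 0) q else 0)"
      by (rule step_branches) (use Suc.IH k in \<open>auto simp: D_def\<close>)
    moreover have "run D V s (Suc (Suc k)) q x =
        (if halting D q then 0 else step D V (s ! Suc k) (run D V s (Suc k)) q x)"
      by simp
    ultimately show ?case
      using V[OF vN[OF k], of 0 q] V[OF vN[OF k], of "Suc 0" q] Suc.prems
      by (auto simp: branches_def sS[OF k] out[OF k] simp del: run.simps)
  qed
  have step: "step D V (s ! Suc k) (run D V s (Suc k)) p x =
        (if x = tops (take k ds) @ outf D (s ! Suc k) 0 then c * V (s ! Suc k) 0 p else 0)
        + (if x = bots (take k ds) @ outf D (s ! Suc k) (Suc 0) then c * V (s ! Suc k) (Suc 0) p else 0)"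
    if "k \<le> length v" for k p x
    by (rule step_branches) (use run[OF that] in \<open>auto simp: D_def\<close>)
  show "step D V (s ! k) (run D V s k) p w = 0" if "k \<le> length v" "p \<in> {3, 4}"
  proof (cases k)
    case 0
    then show ?thesis using first that VL by (auto simp del: run.simps)
  next
    case (Suc j)
    then have j: "j < length v" using that by simp
    have "V (v ! j) 0 p = 0" "V (v ! j) (Suc 0) p = 0"
      using V[OF vN[OF j]] that(2) by auto
    then show ?thesis using step[of j p w] j by (simp add: Suc sS del: run.simps)
  qed
  have "take (length v) ds = ds" by (simp add: ds_def)
  moreover have "outf D (Suc N) 0 = []" "outf D (Suc N) (Suc 0) = e"
    by (simp_all add: D_def N_def outf_transducer)
  ultimately show "step D V (s ! Suc (length v)) (run D V s (Suc (length v))) 3 w =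
      (if w = tops ds then c else 0)"
    "step D V (s ! Suc (length v)) (run D V s (Suc (length v))) 4 w =
      (if w = bots ds @ e then c else 0)"
    unfolding step[OF order_refl] unfolding sl by (simp_all add: VR)
qed

text \<open>\<open>g\<close> will be the identity for probabilities and the squared modulus for
  amplitudes. The branches end in different accepting states, so \<open>g\<close> acts on each
  weight separately and amplitudes do not interfere even when both outputs coincide.\<close>

lemma transducer_sum:
  fixes V :: "nat \<Rightarrow> nat \<Rightarrow> nat \<Rightarrow> 'a::comm_ring_1" and g :: "'a \<Rightarrow> real" and L R K doms e v c
  defines "D \<equiv> transducer L R K doms e"
  defines "N \<equiv> length doms"
  defines "s \<equiv> tape D v"
  defines "ds \<equiv> map ((!) doms) v"
  assumes V: "\<And>i q p. i < N \<Longrightarrow> q < 6 \<Longrightarrow> p < 6 \<Longrightarrow> V i q p = (if q = p then 1 else 0)"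
    and VL: "V N 2 0 = c" "V N 2 (Suc 0) = c" "V N 2 2 = 0" "V N 2 3 = 0" "V N 2 4 = 0"
    and VR: "V (Suc N) 0 3 = 1" "V (Suc N) 0 4 = 0" "V (Suc N) (Suc 0) 3 = 0" "V (Suc N) (Suc 0) 4 = 1"
    and v: "v \<in> lists {..<N}" and g: "g 0 = 0"
  shows "(\<Sum>k<length s. \<Sum>p\<in>set (accs D). g (step D V (s ! k) (run D V s k) p w)) =
    (if w = tops ds then g c else 0) + (if w = bots ds @ e then g c else 0)"
proof -
  note ts = transducer_step[where V = V and L = L and R = R and K = K and doms = doms and e = e
      and v = v and c = c, folded N_def D_def, folded s_def ds_def, OF V VL VR v]
  have "length s = Suc (Suc (length v))" by (simp add: s_def tape_def)
  moreover have "(\<Sum>k<Suc (length v). \<Sum>p\<in>set (accs D). g (step D V (s ! k) (run D V s k) p w)) = 0"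
    using ts(1) g by (intro sum.neutral ballI) (auto simp: D_def simp del: run.simps)
  moreover have "set (accs D) = {3, 4}" by (simp add: D_def)
  ultimately show ?thesis using ts(2,3) g by (simp add: sum.lessThan_Suc[of _ "Suc (length v)"] del: run.simps sum.lessThan_Suc)
qed

section \<open>Probabilities and validity\<close>

definition agreement :: "(nat list \<times> nat list) list \<Rightarrow> nat list \<Rightarrow> (nat list \<times> nat list) set" where
  "agreement doms e = {(v, w). v \<in> lists {..<length doms} \<and>
     w = tops (map ((!) doms) v) \<and> w = bots (map ((!) doms) v) @ e}"

definition bounded_dominoes :: "nat \<Rightarrow> (nat list \<times> nat list) list \<Rightarrow> bool" where
  "bounded_dominoes K doms \<longleftrightarrow> (\<forall>d\<in>set doms. set (fst d) \<subseteq> {..<K} \<and> set (snd d) \<subseteq> {..<K})"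

lemma tops_bounded:
  "bounded_dominoes K doms \<Longrightarrow> v \<in> lists {..<length doms} \<Longrightarrow> tops (map ((!) doms) v) \<in> lists {..<K}"
  by (force simp: bounded_dominoes_def in_lists_conv_set)

text \<open>The thresholds 2/3 and 1/3 exclude each other, so \<open>P\<close> determines the
  relation; this is what gives the definite description in the theorem its value.\<close>

lemma computes_with_unique:
  assumes "computes_with P k1 k2 R (2/3)" and "computes_with P k1 k2 R' (2/3)"
  shows "R = R'"
proof -
  have "R \<subseteq> R'" if "computes_with P k1 k2 R (2/3)" "computes_with P k1 k2 R' (2/3)" for R R'
  proof
    fix x assume x: "x \<in> R"
    obtain v w where vw: "x = (v, w)" by (cases x)
    with x that(1) have v: "v \<in> lists {..<k1}" "w \<in> lists {..<k2}" by (auto simp: computes_with_def)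
    have "P v w \<ge> 2/3" using that(1) v x vw unfolding computes_with_def by blast
    moreover have "P v w \<le> 1 - 2/3" if "x \<notin> R'"
      using \<open>computes_with P k1 k2 R' (2/3)\<close> v that vw unfolding computes_with_def by blast
    ultimately show "x \<in> R'" by fastforce
  qed
  with assms show ?thesis by blast
qed

text \<open>The possible values are 0, 1/3 and 2/3, the last exactly when both words equal
  \<open>w\<close>.\<close>

lemma computes_with_agreement:
  assumes "bounded_dominoes K doms"
    and "\<And>v w. v \<in> lists {..<length doms} \<Longrightarrow> P v w =
      (if w = tops (map ((!) doms) v) then 1/3 else 0) +
      (if w = bots (map ((!) doms) v) @ e then 1/3 else 0)"
  shows "computes_with P (length doms) K (agreement doms e) (2/3)"
proof -
  have "agreement doms e \<subseteq> lists {..<length doms} \<times> lists {..<K}"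
    using tops_bounded[OF assms(1)] by (auto simp: agreement_def)
  then show ?thesis
    unfolding computes_with_def using assms(2) by (simp add: agreement_def)
qed

definition pleft :: "nat \<Rightarrow> nat \<Rightarrow> alg_desc" where
  "pleft q p = (if q = 2 then (if p \<in> {0, 1, 5} then alg_third else alg_zero) else delta q p)"

definition pright :: "nat \<Rightarrow> nat \<Rightarrow> alg_desc" where
  "pright q p = delta (if q < 3 then q + 3 else q) p"

lemma pfst_transducer:
  fixes K :: nat and doms e
  defines "D \<equiv> transducer pleft pright K doms e"
  assumes "bounded_dominoes K doms" and "set e \<subseteq> {..<K}"
  shows "pfst_valid D" and "pfst_computes D (agreement doms e) (2/3)"
proof -
  let ?N = "length doms"
  have left: "alg_val (pleft q p) = of_real (if q = 2 then (if p \<in> {0, 1, 5} then 1/3 else 0)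
      else if q = p then 1 else 0)" for q p
    by (simp add: pleft_def alg_third alg_zero delta)
  have right: "alg_val (pright q p) = of_real (if (if q < 3 then q + 3 else q) = p then 1 else 0)" for q p
    by (simp add: pright_def delta)
  have valid: "valid_common D"
    unfolding D_def using assms(2,3)
    by (intro valid_common_transducer)
      (auto simp: pleft_def pright_def alg_third alg_zero delta bounded_dominoes_def)
  have V: "Vr D i q p = (if q = p then 1 else 0)" if "i < ?N" "q < 6" "p < 6" for i q p
    using that by (simp add: Vr_def D_def Vc_transducer)
  have VL: "Vr D ?N q p = (if q = 2 then (if p \<in> {0, 1, 5} then 1/3 else 0)
      else if q = p then 1 else 0)" if "q < 6" "p < 6" for q p
    using that by (simp add: Vr_def D_def Vc_transducer left)
  have VR: "Vr D (Suc ?N) q p = (if (if q < 3 then q + 3 else q) = p then 1 else 0)"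
    if "q < 6" "p < 6" for q p
    using that by (simp add: Vr_def D_def Vc_transducer right)
  have Im0: "Im (Vc D a q p) = 0" if "a < ?N + 2" "q < 6" "p < 6" for a q p
  proof -
    from that(1) consider "a < ?N" | "a = ?N" | "a = Suc ?N" by linarith
    then show ?thesis using that(2,3) by cases (simp_all add: D_def Vc_transducer left right)
  qed
  have nonneg: "0 \<le> Vr D a q p" and sum1: "(\<Sum>p<6. Vr D a q p) = 1"
    if "a < ?N + 2" "q < 6" "p < 6" for a q p
  proof -
    from that(1) consider "a < ?N" | "a = ?N" | "a = Suc ?N" by linarith
    then show "0 \<le> Vr D a q p" using that(2,3) by cases (simp_all add: V VL VR)
    from that(1) consider "a < ?N" | "a = ?N" | "a = Suc ?N" by linarith
    then show "(\<Sum>p<6. Vr D a q p) = 1"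
    proof cases
      case 1
      then show ?thesis using that(2) by (simp add: V)
    next
      case 2
      have "\<forall>q<6. (\<Sum>p<6. Vr D ?N q p) = 1"
        unfolding all_less_6 sum_less_6 by (simp add: VL)
      with 2 that(2) show ?thesis by blast
    next
      case 3
      then show ?thesis using that(2) by (simp add: VR)
    qed
  qed
  have halt: "Vr D (Suc ?N) q p = 0" if "q < 6" "p < 6" "\<not> halting D p" for q p
  proof -
    have "p \<notin> {3, 4, 5}" using that(3) by (simp add: D_def halting_transducer)
    then show ?thesis using that(1,2) by (auto simp: VR)
  qed
  show "pfst_valid D"
    unfolding pfst_valid_def using valid Im0 nonneg sum1[of _ _ 0] halt by (simp add: D_def)
  have "pfst_prob D v w = (if w = tops (map ((!) doms) v) then 1/3 else 0) +
      (if w = bots (map ((!) doms) v) @ e then 1/3 else 0)" if "v \<in> lists {..<?N}" for v w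
    unfolding pfst_prob_def Let_def D_def
    by (rule transducer_sum[where g = "\<lambda>x. x"])
      (use V VL VR that in \<open>simp_all add: D_def[symmetric]\<close>)
  then show "pfst_computes D (agreement doms e) (2/3)"
    unfolding pfst_computes_def using computes_with_agreement[OF assms(2), of "pfst_prob D" e]
    by (simp add: D_def)
qed

text \<open>On the states 2, 0, 1, 5 this is a conference matrix of order 4 divided by sqrt 3.\<close>

definition qleft :: "nat \<Rightarrow> nat \<Rightarrow> alg_desc" where
  "qleft q p =
    (let o' = alg_zero; i = alg_one; r = alg_root; n = alg_neg_root in
     [[o', r, n, o', o', n],
      [n, o', n, o', o', r],
      [r, r, o', o', o', r],
      [o', o', o', i, o', o'],
      [o', o', o', o', i, o'],
      [r, n, n, o', o', o']] ! q ! p)"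

text \<open>Unlike \<open>pright\<close> this is a permutation, as unitarity demands. Exchanging
  halting and non-halting states is allowed, because validity forces only the entries between
  non-halting states to vanish.\<close>

definition qright :: "nat \<Rightarrow> nat \<Rightarrow> alg_desc" where
  "qright q p = delta ((q + 3) mod 6) p"

lemma qfst_transducer:
  fixes K :: nat and doms e
  defines "D \<equiv> transducer qleft qright K doms e"
  assumes "bounded_dominoes K doms" and "set e \<subseteq> {..<K}"
  shows "qfst_valid D" and "qfst_computes D (agreement doms e) (2/3)"
proof -
  let ?N = "length doms"
  define r :: complex where "r = of_real (1 / sqrt 3)"
  have r2: "r * r = 1/3" "r * cnj r = 1/3"
    by (simp_all add: r_def flip: of_real_mult)
  have "(\<forall>q<6. \<forall>p<6. valid_alg (qleft q p))"
    unfolding all_less_6 by (simp add: qleft_def Let_def alg_zero alg_one alg_root alg_neg_root)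
  then have valid: "valid_common D"
    unfolding D_def using assms(2,3)
    by (intro valid_common_transducer) (auto simp: qright_def delta bounded_dominoes_def)
  have V: "Vc D i q p = (if q = p then 1 else 0)" if "i < ?N" "q < 6" "p < 6" for i q p
    using that by (simp add: D_def Vc_transducer)
  have VL: "Vc D ?N q p = 
     [[0, r, -r, 0, 0, -r],
      [-r, 0, -r, 0, 0, r],
      [r, r, 0, 0, 0, r],
      [0, 0, 0, 1, 0, 0],
      [0, 0, 0, 0, 1, 0],
      [r, -r, -r, 0, 0, 0]] ! q ! p" if "q < 6" "p < 6" for q p
  proof -
    have "\<forall>q<6. \<forall>p<6. alg_val (qleft q p) = 
     [[0, r, -r, 0, 0, -r],
      [-r, 0, -r, 0, 0, r],
      [r, r, 0, 0, 0, r],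
      [0, 0, 0, 1, 0, 0],
      [0, 0, 0, 0, 1, 0],
      [r, -r, -r, 0, 0, 0]] ! q ! p"
      unfolding all_less_6 by (simp add: qleft_def Let_def alg_zero alg_one alg_root alg_neg_root r_def)
    then show ?thesis using that by (simp add: D_def Vc_transducer)
  qed
  have VR: "Vc D (Suc ?N) q p = (if (q + 3) mod 6 = p then 1 else 0)"
    if "q < 6" "p < 6" for q p
    using that by (simp add: D_def Vc_transducer qright_def delta)
  have orth_left: "\<forall>q<6. \<forall>q'<6. (\<Sum>p<6. Vc D ?N q p * cnj (Vc D ?N q' p)) = (if q = q' then 1 else 0)"
    unfolding all_less_6 sum_less_6 by (simp add: VL r2)
  have orth_right: "\<forall>q<6. \<forall>q'<6. (\<Sum>p<6. Vc D (Suc ?N) q p * cnj (Vc D (Suc ?N) q' p)) = (if q = q' then 1 else 0)"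
    unfolding all_less_6 sum_less_6 by (simp add: VR)
  have orth: "(\<Sum>p<6. Vc D a q p * cnj (Vc D a q' p)) = (if q = q' then 1 else 0)"
    if "a < ?N + 2" "q < 6" "q' < 6" for a q q'
  proof -
    from that(1) consider "a < ?N" | "a = ?N" | "a = Suc ?N" by linarith
    then show ?thesis
    proof cases
      case 1
      have "\<forall>q<6. \<forall>q'<6. (\<Sum>p<6. Vc D a q p * cnj (Vc D a q' p)) = (if q = q' then 1 else 0)"
        unfolding all_less_6 sum_less_6 by (simp add: V[OF 1])
      with that show ?thesis by blast
    qed (use orth_left orth_right that in blast)+
  qed
  have "halting D p \<longleftrightarrow> p \<in> {3, 4, 5}" for p
    by (simp add: D_def halting_transducer)
  then have "\<forall>q<6. \<forall>p<6. \<not> halting D q \<and> \<not> halting D p \<longrightarrow> Vc D (Suc ?N) q p = 0"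
    unfolding all_less_6 by (simp add: VR)
  then show "qfst_valid D"
    unfolding qfst_valid_def using valid orth by (simp add: D_def)
  have g: "(cmod r)\<^sup>2 = 1/3" by (simp add: r_def norm_divide power_divide)
  have "qfst_prob D v w = (if w = tops (map ((!) doms) v) then (cmod r)\<^sup>2 else 0) +
      (if w = bots (map ((!) doms) v) @ e then (cmod r)\<^sup>2 else 0)" if "v \<in> lists {..<?N}" for v w
    unfolding qfst_prob_def Let_def D_def
    by (rule transducer_sum[where g = "\<lambda>x. (cmod x)\<^sup>2"])
      (use V VL VR that in \<open>simp_all add: D_def[symmetric]\<close>)
  then show "qfst_computes D (agreement doms e) (2/3)"
    unfolding qfst_computes_def using computes_with_agreement[OF assms(2), of "qfst_prob D" e] g
    by (simp add: D_def)
qed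

section \<open>Diagonalisation\<close>

lemma computable_cong:
  "computable n f \<Longrightarrow> (\<And>xs. length xs = n \<Longrightarrow> f xs = g xs) \<Longrightarrow> computable n g"
  unfolding computable_def by metis

text \<open>The inputs are the number of dominoes, the size of the output alphabet, the code of the
  transition matrices, and the code of all output words except those on letter 0; on letter 0
  state 0 emits the start word built from these four numbers themselves.\<close>

definition self_code :: "nat list \<Rightarrow> nat" where
  "self_code xs = list_encode [6, xs ! 0, xs ! 1, 2, list_encode [3, 4], list_encode [5], xs ! 2,
     Suc (prod_encode (list_encode [list_encode (map code (Hash # Start # frame xs)), 0, 0, 0, 0, 0],
       xs ! 3))]"

text \<open>\<open>Inc\<close> and \<open>Zero\<close> have the codes 2 and 1, so prepending a
  number to a coded word iterates one fixed function, a form that \<open>computable_funpow\<close>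
  covers.\<close>

lemma list_encode_num:
  "list_encode (map code (num x) @ w) =
     ((\<lambda>y. Suc (prod_encode (2, y))) ^^ x) (Suc (prod_encode (1, list_encode w)))"
  by (induction x) (auto simp: code_def)

lemma computable_self_code: "computable 4 self_code"
proof (rule computable_cong)
  let ?num = "\<lambda>x y. ((\<lambda>y. Suc (prod_encode (2, y))) ^^ x) (Suc (prod_encode (1, y)))"
  let ?start = "\<lambda>xs. Suc (prod_encode (0, Suc (prod_encode (4,
      ?num (xs ! 0) (?num (xs ! 1) (?num (xs ! 2) (?num (xs ! 3) 0)))))))"
  let ?f = "\<lambda>xs. list_encode [6, xs ! 0, xs ! 1, 2, list_encode [3, 4], list_encode [5], xs ! 2,
     Suc (prod_encode (list_encode [?start xs, 0, 0, 0, 0, 0], xs ! 3))]"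
  show "computable 4 ?f"
    unfolding list_encode.simps
    by (intro computable_Suc computable_prod_encode computable_const computable_funpow computable_nth) simp_all
  fix xs :: "nat list" assume "length xs = 4"
  then obtain a b c d where "xs = [a, b, c, d]"
    by (auto simp: length_Suc_conv eval_nat_numeral)
  moreover have "list_encode (map code (Hash # Start # w)) =
      Suc (prod_encode (0, Suc (prod_encode (4, list_encode (map code w)))))" for w
    by (simp add: code_def)
  ultimately show "?f xs = self_code xs"
    using list_encode_num[of d "[]"] by (simp add: self_code_def list_encode_num del: funpow.simps)
qed

text \<open>Input words are lists of domino indices, and an injective recoding of letters preserves
  and reflects equality of words.\<close>

lemma agreement_nonempty_iff:
  assumes "inj h" and "doms = map (map_prod (map h) (map h)) ds0"
  shows "agreement doms (map h e) \<noteq> {} \<longleftrightarrow> (\<exists>ds. set ds \<subseteq> set ds0 \<and> tops ds = bots ds @ e)"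
proof -
  have eq: "tops (map ((!) doms) v) = bots (map ((!) doms) v) @ map h e \<longleftrightarrow>
      tops (map ((!) ds0) v) = bots (map ((!) ds0) v) @ e" if "v \<in> lists {..<length ds0}" for v
  proof -
    have m: "map ((!) doms) v = map (map_prod (map h) (map h)) (map ((!) ds0) v)"
      using that by (auto simp: assms(2) in_lists_conv_set)
    have "tops (map ((!) doms) v) = map h (tops (map ((!) ds0) v))"
      "bots (map ((!) doms) v) = map h (bots (map ((!) ds0) v))"
      unfolding m by (simp_all add: map_concat comp_def)
    then show ?thesis using inj_map_eq_map[OF assms(1)] by (metis map_append)
  qed
  have "agreement doms (map h e) \<noteq> {} \<longleftrightarrow>
      (\<exists>v\<in>lists {..<length ds0}. tops (map ((!) ds0) v) = bots (map ((!) ds0) v) @ e)"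
    using eq by (auto simp: agreement_def assms(2) simp del: map_map)
  also have "\<dots> \<longleftrightarrow> (\<exists>ds. set ds \<subseteq> set ds0 \<and> tops ds = bots ds @ e)"
  proof
    assume "\<exists>v\<in>lists {..<length ds0}. tops (map ((!) ds0) v) = bots (map ((!) ds0) v) @ e"
    then obtain v where v: "v \<in> lists {..<length ds0}"
      "tops (map ((!) ds0) v) = bots (map ((!) ds0) v) @ e" by blast
    then have "set (map ((!) ds0) v) \<subseteq> set ds0" by auto
    with v(2) show "\<exists>ds. set ds \<subseteq> set ds0 \<and> tops ds = bots ds @ e" by blast
  next
    assume "\<exists>ds. set ds \<subseteq> set ds0 \<and> tops ds = bots ds @ e"
    then obtain ds where ds: "set ds \<subseteq> set ds0" "tops ds = bots ds @ e" by blast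
    then have "set ds \<subseteq> (!) ds0 ` {..<length ds0}" by (auto simp: set_conv_nth)
    then have "ds \<in> map ((!) ds0) ` lists {..<length ds0}" 
      unfolding lists_image[symmetric] in_lists_conv_set by blast
    with ds(2) show "\<exists>v\<in>lists {..<length ds0}. tops (map ((!) ds0) v) = bots (map ((!) ds0) v) @ e"
      by blast
  qed
  finally show ?thesis .
qed

text \<open>With the end marker matrices and the promise left open, the probabilistic and the
  quantum case share one diagonal argument.\<close>

lemma not_decidable:
  assumes good: "\<And>K doms e. bounded_dominoes K doms \<Longrightarrow> set e \<subseteq> {..<K} \<Longrightarrow>
    Promise (transducer L R K doms e) \<and>
    (Answer (transducer L R K doms e) \<longleftrightarrow> agreement doms e = {})"
  shows "\<not> decides_promise M Promise Answer"
proof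
  assume M: "decides_promise M Promise Answer"
  from computable_self_code obtain E where
    E: "\<And>xs. length xs = 4 \<Longrightarrow> reval E xs (self_code xs)"
    unfolding computable_def by blast
  \<comment> \<open>\<open>?F\<close> asks \<open>M\<close> about the transducer whose code
    \<open>self_code\<close> assembles from the arguments.\<close>
  let ?F = "Cn M [E]"
  from program_correspondence[of 4 ?F] obtain rest where
    rest: "\<And>xs. length xs = 4 \<Longrightarrow> reval ?F xs 1 \<longleftrightarrow>
      (\<exists>ds. set ds \<subseteq> set ((Hash # Start # frame xs, []) # rest) \<and> tops ds = bots ds @ [Hash, Yes])"
    by blast
  let ?cd = "map_prod (map code) (map code)"
  let ?row = "\<lambda>d. [fst d, snd d, [], [], [], []]"
  define e where "e = map code [Hash, Yes]"
  have "finite (\<Union>d\<in>set (map ?cd rest). set (fst d) \<union> set (snd d))" by simp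
  then obtain K0 where bound: "\<forall>n\<in>(\<Union>d\<in>set (map ?cd rest). set (fst d) \<union> set (snd d)). n < K0"
    unfolding finite_nat_set_iff_bounded ..
  have K0: "set (fst d) \<subseteq> {..<K0} \<and> set (snd d) \<subseteq> {..<K0}" if "d \<in> set (map ?cd rest)" for d
    using bound that by blast
  \<comment> \<open>The letters of the start word have codes below 5 whatever \<open>xs\<close> is,
    so the output alphabet can be fixed before \<open>xs\<close>.\<close>
  define K where "K = max 5 K0"
  define N where "N = Suc (length rest)"
  define mats where "mats = replicate N (mat6 delta) @ [mat6 L, mat6 R]"
  define TC where "TC = list_encode (map (\<lambda>A. list_encode (map (\<lambda>r. list_encode (map enc_alg r)) A)) mats)"
  define RC where "RC = list_encode (map (\<lambda>A. list_encode (map list_encode A))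
    (map ?row (map ?cd rest) @ [replicate 6 [], [[], e, [], [], [], []]]))"
  \<comment> \<open>None of these four numbers involves the start domino, so that domino can spell
    them out without circularity.\<close>
  define xs where "xs = [N, K, TC, RC]"
  define ds0 where "ds0 = (Hash # Start # frame xs, []) # rest"
  define doms where "doms = map ?cd ds0"
  define D where "D = transducer L R K doms e"
  have len: "length xs = 4" by (simp add: xs_def)
  have doms: "doms = (map code (Hash # Start # frame xs), []) # map ?cd rest"
    by (simp add: doms_def ds0_def)
  have "set (map code (Hash # Start # frame xs)) \<subseteq> {..<K}"
    by (auto simp: frame_def num_def code_def K_def)
  moreover have "set (fst d) \<subseteq> {..<K} \<and> set (snd d) \<subseteq> {..<K}" if "d \<in> set (map ?cd rest)" for d
    using K0[OF that] by (fastforce simp: K_def)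
  ultimately have "bounded_dominoes K doms"
    unfolding bounded_dominoes_def doms by auto
  moreover have "set e \<subseteq> {..<K}" by (simp add: e_def code_def K_def less_max_iff_disj)
  ultimately have D: "Promise D" "Answer D \<longleftrightarrow> agreement doms e = {}"
    using good unfolding D_def by blast+
  \<comment> \<open>The fixed point: the code of \<open>D\<close> is computed from the very numbers
    contained in its own start domino.\<close>
  have "enc D = self_code xs"
    by (simp add: enc_def D_def transducer_def self_code_def xs_def[symmetric] doms)
      (simp add: xs_def N_def mats_def TC_def RC_def)
  then have EE: "reval E xs (enc D)" using E[OF len] by simp
  have "reval ?F xs 1 \<longleftrightarrow> reval M [enc D] 1"
  proof
    assume "reval ?F xs 1"
    then obtain ys where "length ys = 1" "reval E xs (ys ! 0)" "reval M ys 1"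
      by (cases rule: reval.cases) auto
    moreover from this have "ys = [enc D]"
      using reval_deterministic[OF EE] by (cases ys) auto
    ultimately show "reval M [enc D] 1" by simp
  next
    assume "reval M [enc D] 1"
    then show "reval ?F xs 1" using EE by (intro reval_Cn[of "[enc D]"]) auto
  qed
  moreover have "agreement doms e \<noteq> {} \<longleftrightarrow> reval ?F xs 1"
    using agreement_nonempty_iff[OF inj_code doms_def, of "[Hash, Yes]"] rest[OF len]
    unfolding e_def ds0_def by blast
  \<comment> \<open>The dominoes admit agreement exactly when \<open>M\<close> returns 1, whereas a
    correct \<open>M\<close> returns 1 exactly when they do not.\<close>
  ultimately have "\<not> Answer D \<longleftrightarrow> reval M [enc D] 1" using D(2) by simp
  moreover have "reval M [enc D] (if Answer D then 1 else 0)"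
    using M D(1) unfolding decides_promise_def by blast
  ultimately show False
    using reval_deterministic[of M "[enc D]" 1 0] by (cases "Answer D") auto
qed

theorem theorem2:
  shows "\<not> (\<exists>M. decides_promise M
              (\<lambda>D. pfst_valid D \<and> (\<exists>R. pfst_computes D R (2/3)))
              (\<lambda>D. (THE R. pfst_computes D R (2/3)) = {}))
       \<and> \<not> (\<exists>M. decides_promise M
              (\<lambda>D. qfst_valid D \<and> (\<exists>R. qfst_computes D R (2/3)))
              (\<lambda>D. (THE R. qfst_computes D R (2/3)) = {}))"
proof -
  have p: "(THE R. pfst_computes D R (2/3)) = A" if "pfst_computes D A (2/3)" for D A
    using that computes_with_unique unfolding pfst_computes_def by (intro the_equality) blast+
  have q: "(THE R. qfst_computes D R (2/3)) = A" if "qfst_computes D A (2/3)" for D A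
    using that computes_with_unique unfolding qfst_computes_def by (intro the_equality) blast+
  have "\<not> decides_promise M
      (\<lambda>D. pfst_valid D \<and> (\<exists>R. pfst_computes D R (2/3)))
      (\<lambda>D. (THE R. pfst_computes D R (2/3)) = {})" for M
    by (rule not_decidable[of _ pleft pright]) (use pfst_transducer p in blast)
  moreover have "\<not> decides_promise M
      (\<lambda>D. qfst_valid D \<and> (\<exists>R. qfst_computes D R (2/3)))
      (\<lambda>D. (THE R. qfst_computes D R (2/3)) = {})" for M
    by (rule not_decidable[of _ qleft qright]) (use qfst_transducer q in blast)
  ultimately show ?thesis by blast
qed

end
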